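(* Let $(E,T)$ be an output-stable pair with $E\in\mathcal L(\mathcal X,\mathcal Y)$ and $T\in\mathcal L(\mathcal X)$, let $S\in\mathcal S(\mathcal U,\mathcal Y)$ be a Schur-class function with Taylor expansion $S(z)=\sum_{j\ge0}S_jz^j$, and let $N\in\mathcal L(\mathcal X,\mathcal U)$ be defined by $$N:=\sum_{j=0}^\infty S_j^*ET^j,$$ or equivalently, via its adjoint, $N^*=\mathcal O_{E,T}^*M_S|_{\mathcal U}:\mathcal U\to\mathcal X$. Then the data set $\{S,T,E,N,\mathbf x\}$ is $\mathbf{AIP}_{\mathcal H(K_S)}$-admissible for every $\mathbf x\in\mathcal X$. Furthermore, $M_{F^S}^{[*]}=\mathcal O_{E,T}^*|_{\mathcal H(K_S)}$, so that the interpolation conditions $$\|f\|_{\mathcal H(K_S)}\le1\quad\text{and}\quad(E^*f)^{\wedge L}(T^* )=\mathcal O_{E,T}^*f=\mathbf x$$ coincide with the conditions $$M_{F^S}^{[*]}f=\mathbf x\quad\text{and}\quad\|f\|_{\mathcal H(K_S)}\le1 .$$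
   Context: $\mathcal X,\mathcal U,\mathcal Y$ are complex Hilbert spaces; $\mathcal L(\cdot,\cdot)$ denotes bounded operators; $\mathbb D$ is the open unit disk; $\mathrm{Hol}_{\mathcal Y}(\mathbb D)$ is the space of $\mathcal Y$-valued holomorphic functions on $\mathbb D$; $H^2_{\mathcal Y}$ is the Hardy space of $\mathcal Y$-valued functions on $\mathbb D$ with square-summable Taylor coefficients. $\mathcal S(\mathcal U,\mathcal Y)$ is the set of analytic functions on $\mathbb D$ with contractive values in $\mathcal L(\mathcal U,\mathcal Y)$; $M_S:H^2_{\mathcal U}\to H^2_{\mathcal Y}$ is multiplication by $S$, and $\mathcal U\subset H^2_{\mathcal U}$ as constant functions. $\mathcal H(K_S)\subset H^2_{\mathcal Y}$ is the reproducing kernel Hilbert space with kernel $K_S(z,\zeta)=\frac{I-S(z)S(\zeta)^*}{1-z\bar\zeta}$. $A^*$ denotes the adjoint in the metric of $H^2_{\mathcal Y}$ and $A^{[*]}$ the adjoint in the metric of $\mathcal H(K_S)$. Observability operator: $\mathcal O_{E,T}:x\mapsto E(I-zT)^{-1}x=\sum_{n\ge0}z^nET^nx$. $(E,T)$ is an analytic output pair if $\mathcal O_{E,T}$ maps $\mathcal X$ into $\mathrm{Hol}_{\mathcal Y}(\mathbb D)$, and output-stable if moreover $\mathcal O_{E,T}\in\mathcal L(\mathcal X,H^2_{\mathcal Y})$. For an output-stable pair and $f(z)=\sum_nf_nz^n\in H^2_{\mathcal Y}$, $(E^*f)^{\wedge L}(T^* )=\sum_{n\ge0}T^{*n}E^*f_n$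 (weakly convergent), which equals $\mathcal O_{E,T}^*f$. A data set $\{S,T,E,N,\mathbf x\}$ with $S\in\mathcal S(\mathcal U,\mathcal Y)$, $T\in\mathcal L(\mathcal X)$, $E\in\mathcal L(\mathcal X,\mathcal Y)$, $N\in\mathcal L(\mathcal X,\mathcal U)$, $\mathbf x\in\mathcal X$ is $\mathbf{AIP}_{\mathcal H(K_S)}$-admissible if: (i) $(E,T)$ and $(N,T)$ are analytic output pairs; (ii) with $F^S(z)=(E-S(z)N)(I-zT)^{-1}$, the operator $M_{F^S}=\mathcal O_{E,T}-M_S\mathcal O_{N,T}:x\mapsto F^Sx$ maps $\mathcal X$ into $\mathcal H(K_S)$; (iii) $P:=M_{F^S}^{[*]}M_{F^S}$ satisfies $P-T^*PT=E^*E-N^*N$. *)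

theory Defs
  imports "HOL-Analysis.Analysis"
begin

section \<open>Complex Hilbert spaces\<close>

class complex_normed_vector = real_normed_vector +
  fixes scaleC :: "complex \<Rightarrow> 'a \<Rightarrow> 'a" (infixr "*\<^sub>C" 75)
  assumes scaleC_add_right: "c *\<^sub>C (x + y) = c *\<^sub>C x + c *\<^sub>C y"
    and scaleC_add_left: "(c + d) *\<^sub>C x = c *\<^sub>C x + d *\<^sub>C x"
    and scaleC_scaleC: "c *\<^sub>C d *\<^sub>C x = (c * d) *\<^sub>C x"
    and scaleC_of_real: "of_real r *\<^sub>C x = r *\<^sub>R x"
    and norm_scaleC: "norm (c *\<^sub>C x) = cmod c * norm x"

text \<open>Inner products are linear in the first argument.\<close>

class complex_hilbert = complex_normed_vector + banach +
  fixes cinner :: "'a \<Rightarrow> 'a \<Rightarrow> complex"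
  assumes cinner_commute: "cinner x y = cnj (cinner y x)"
    and cinner_add_left: "cinner (x + y) z = cinner x z + cinner y z"
    and cinner_scaleC_left: "cinner (c *\<^sub>C x) y = c * cinner x y"
    and cinner_self: "cinner x x = of_real ((norm x)\<^sup>2)"

definition bounded_clinear ::
  "('a::complex_normed_vector \<Rightarrow> 'b::complex_normed_vector) \<Rightarrow> bool" where
  "bounded_clinear A \<longleftrightarrow> bounded_linear A \<and> (\<forall>c x. A (c *\<^sub>C x) = c *\<^sub>C A x)"

lemma bounded_clinear_scaleC: "bounded_linear (\<lambda>x::'a::complex_normed_vector. c *\<^sub>C x)"
proof (rule bounded_linear_intro[where K = "cmod c"])
  fix r :: real and x :: 'a
  show "c *\<^sub>C (r *\<^sub>R x) = r *\<^sub>R (c *\<^sub>C x)"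
    by (simp add: scaleC_of_real[symmetric] scaleC_scaleC mult.commute)
qed (simp_all add: scaleC_add_right norm_scaleC mult.commute)

text \<open>
  The library type of bounded operators consists of real-linear maps. When the target is complex,
  it is a complex normed space under pointwise multiplication by scalars, and the complex-linear
  operators form a closed complex subspace. This gives the operator norm and the norm topology
  on the complex-linear bounded operators.
\<close>

instantiation blinfun :: (real_normed_vector, complex_normed_vector) complex_normed_vector
begin

definition scaleC_blinfun :: "complex \<Rightarrow> ('a \<Rightarrow>\<^sub>L 'b) \<Rightarrow> ('a \<Rightarrow>\<^sub>L 'b)" where
  "scaleC_blinfun c A = Blinfun (\<lambda>x. c *\<^sub>C blinfun_apply A x)"

lemma scaleC_blinfun_apply:
  fixes A :: "'a \<Rightarrow>\<^sub>L 'b"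
  shows "blinfun_apply (c *\<^sub>C A) x = c *\<^sub>C blinfun_apply A x"
proof -
  have "bounded_linear (\<lambda>x. c *\<^sub>C blinfun_apply A x)"
    by (rule bounded_linear_compose[OF bounded_clinear_scaleC blinfun.bounded_linear_right])
  then show ?thesis
    by (simp add: scaleC_blinfun_def bounded_linear_Blinfun_apply)
qed

instance
proof
  fix c d :: complex and r :: real and A B :: "'a \<Rightarrow>\<^sub>L 'b"
  show "c *\<^sub>C (A + B) = c *\<^sub>C A + c *\<^sub>C B"
    by (rule blinfun_eqI) (simp add: scaleC_blinfun_apply blinfun.add_left scaleC_add_right)
  show "(c + d) *\<^sub>C A = c *\<^sub>C A + d *\<^sub>C A"
    by (rule blinfun_eqI) (simp add: scaleC_blinfun_apply blinfun.add_left scaleC_add_left)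
  show "c *\<^sub>C d *\<^sub>C A = (c * d) *\<^sub>C A"
    by (rule blinfun_eqI) (simp add: scaleC_blinfun_apply scaleC_scaleC)
  show "of_real r *\<^sub>C A = r *\<^sub>R A"
    by (rule blinfun_eqI) (simp add: scaleC_blinfun_apply blinfun.scaleR_left scaleC_of_real)
  have "onorm (blinfun_apply (c *\<^sub>C A)) = onorm (blinfun_apply (cmod c *\<^sub>R A))"
    by (simp add: onorm_def scaleC_blinfun_apply blinfun.scaleR_left norm_scaleC)
  then show "norm (c *\<^sub>C A) = cmod c * norm A"
    by (simp add: norm_blinfun.rep_eq[symmetric])
qed

end

text \<open>
  Adjoint of an operator \<open>A\<close> from a Hilbert space into a space with inner product \<open>ip\<close>, evaluated
  at \<open>f\<close>. The inner product is an argument because the same operator is considered in different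
  metrics on its target.
\<close>

definition adjoint_wrt ::
  "('b \<Rightarrow> 'b \<Rightarrow> complex) \<Rightarrow> ('a::complex_hilbert \<Rightarrow> 'b) \<Rightarrow> 'b \<Rightarrow> 'a" where
  "adjoint_wrt ip A f = (THE x. \<forall>v. cinner v x = ip (A v) f)"

abbreviation cadjoint :: "('a::complex_hilbert \<Rightarrow> 'b::complex_hilbert) \<Rightarrow> 'b \<Rightarrow> 'a" where
  "cadjoint \<equiv> adjoint_wrt cinner"

definition weak_sums :: "(nat \<Rightarrow> 'a::complex_hilbert) \<Rightarrow> 'a \<Rightarrow> bool" where
  "weak_sums g w \<longleftrightarrow> (\<forall>v. (\<lambda>n. cinner (g n) v) sums cinner w v)"

definition weak_suminf :: "(nat \<Rightarrow> 'a::complex_hilbert) \<Rightarrow> 'a" where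
  "weak_suminf g = (THE w. weak_sums g w)"


section \<open>Holomorphic functions and the Hardy space\<close>

abbreviation unit_disk :: "complex set" ("\<D>") where
  "\<D> \<equiv> ball 0 1"

definition vholomorphic_on :: "(complex \<Rightarrow> 'a::complex_normed_vector) \<Rightarrow> complex set \<Rightarrow> bool" where
  "vholomorphic_on f D \<longleftrightarrow> (\<forall>z\<in>D. \<exists>f'. (f has_derivative (\<lambda>h. h *\<^sub>C f')) (at z within D))"

text \<open>
  A function on the disk is represented by its extension by zero to the plane, so that equality
  in the following spaces is equality on the disk.
\<close>

definition Hol :: "(complex \<Rightarrow> 'a::complex_normed_vector) set" where
  "Hol = {f. vholomorphic_on f \<D> \<and> (\<forall>z. z \<notin> \<D> \<longrightarrow> f z = 0)}"

definition taylor_coeff :: "(complex \<Rightarrow> 'a::complex_normed_vector) \<Rightarrow> nat \<Rightarrow> 'a" where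
  "taylor_coeff f = (THE a. \<forall>z\<in>\<D>. (\<lambda>n. z ^ n *\<^sub>C a n) sums f z)"

definition H2 :: "(complex \<Rightarrow> 'a::complex_hilbert) set" where
  "H2 = {f \<in> Hol. summable (\<lambda>n. (norm (taylor_coeff f n))\<^sup>2)}"

definition H2_inner ::
  "(complex \<Rightarrow> 'a::complex_hilbert) \<Rightarrow> (complex \<Rightarrow> 'a) \<Rightarrow> complex" where
  "H2_inner f g = (\<Sum>n. cinner (taylor_coeff f n) (taylor_coeff g n))"

definition ip_norm :: "('b \<Rightarrow> 'b \<Rightarrow> complex) \<Rightarrow> 'b \<Rightarrow> real" where
  "ip_norm ip f = sqrt (Re (ip f f))"

definition const_fun :: "'a::complex_normed_vector \<Rightarrow> complex \<Rightarrow> 'a" where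
  "const_fun u = (\<lambda>z. if z \<in> \<D> then u else 0)"


section \<open>Schur class and de Branges--Rovnyak spaces\<close>

definition schur_class ::
  "(complex \<Rightarrow> ('u::complex_hilbert \<Rightarrow>\<^sub>L 'y::complex_hilbert)) \<Rightarrow> bool" where
  "schur_class S \<longleftrightarrow> vholomorphic_on S \<D> \<and>
     (\<forall>z\<in>\<D>. bounded_clinear (blinfun_apply (S z)) \<and> norm (S z) \<le> 1)"

definition mult_op ::
  "(complex \<Rightarrow> ('u::complex_hilbert \<Rightarrow>\<^sub>L 'y::complex_hilbert)) \<Rightarrow> (complex \<Rightarrow> 'u) \<Rightarrow> complex \<Rightarrow> 'y"
  where "mult_op S f = (\<lambda>z. blinfun_apply (S z) (f z))"

text \<open>A Hilbert space whose elements are functions on the disk, with its own inner product.\<close>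

locale hilbert_function_space =
  fixes H :: "(complex \<Rightarrow> 'y::complex_hilbert) set"
    and ip :: "(complex \<Rightarrow> 'y) \<Rightarrow> (complex \<Rightarrow> 'y) \<Rightarrow> complex"
  assumes vanish: "f \<in> H \<Longrightarrow> z \<notin> \<D> \<Longrightarrow> f z = 0"
    and zero_mem: "(\<lambda>z. 0) \<in> H"
    and add_mem: "f \<in> H \<Longrightarrow> g \<in> H \<Longrightarrow> (\<lambda>z. f z + g z) \<in> H"
    and scale_mem: "f \<in> H \<Longrightarrow> (\<lambda>z. c *\<^sub>C f z) \<in> H"
    and ip_commute: "f \<in> H \<Longrightarrow> g \<in> H \<Longrightarrow> ip f g = cnj (ip g f)"
    and ip_add: "f \<in> H \<Longrightarrow> g \<in> H \<Longrightarrow> h \<in> H \<Longrightarrow> ip (\<lambda>z. f z + g z) h = ip f h + ip g h"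
    and ip_scale: "f \<in> H \<Longrightarrow> g \<in> H \<Longrightarrow> ip (\<lambda>z. c *\<^sub>C f z) g = c * ip f g"
    and ip_nonneg: "f \<in> H \<Longrightarrow> 0 \<le> Re (ip f f)"
    and ip_definite: "f \<in> H \<Longrightarrow> ip f f = 0 \<Longrightarrow> f = (\<lambda>z. 0)"
    and complete:
      "(\<And>n. F n \<in> H) \<Longrightarrow>
       (\<And>e. e > 0 \<Longrightarrow> \<exists>M. \<forall>m\<ge>M. \<forall>n\<ge>M. ip_norm ip (\<lambda>z. F m z - F n z) < e) \<Longrightarrow>
       \<exists>f\<in>H. (\<lambda>n. ip_norm ip (\<lambda>z. F n z - f z)) \<longlonglongrightarrow> 0"

locale rkhs = hilbert_function_space H ip
  for H :: "(complex \<Rightarrow> 'y::complex_hilbert) set"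
    and ip :: "(complex \<Rightarrow> 'y) \<Rightarrow> (complex \<Rightarrow> 'y) \<Rightarrow> complex" +
  fixes K :: "complex \<Rightarrow> complex \<Rightarrow> 'y \<Rightarrow> 'y"
  assumes kernel_mem: "\<zeta> \<in> \<D> \<Longrightarrow> (\<lambda>z. if z \<in> \<D> then K z \<zeta> y else 0) \<in> H"
    and reproducing: "\<zeta> \<in> \<D> \<Longrightarrow> f \<in> H \<Longrightarrow>
      ip f (\<lambda>z. if z \<in> \<D> then K z \<zeta> y else 0) = cinner (f \<zeta>) y"

definition schur_kernel ::
  "(complex \<Rightarrow> ('u::complex_hilbert \<Rightarrow>\<^sub>L 'y::complex_hilbert)) \<Rightarrow> complex \<Rightarrow> complex \<Rightarrow> 'y \<Rightarrow> 'y" where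
  "schur_kernel S z \<zeta> y =
     (1 / (1 - z * cnj \<zeta>)) *\<^sub>C
       (y - blinfun_apply (S z) (cadjoint (blinfun_apply (S \<zeta>)) y))"

text \<open>
  A reproducing kernel determines its space and the inner product on it, so this predicate says
  that \<open>(H, ip)\<close> is \<open>\<H>(K\<^sub>S)\<close>.
\<close>

abbreviation is_HKS ::
  "(complex \<Rightarrow> ('u::complex_hilbert \<Rightarrow>\<^sub>L 'y::complex_hilbert)) \<Rightarrow>
   (complex \<Rightarrow> 'y) set \<Rightarrow> ((complex \<Rightarrow> 'y) \<Rightarrow> (complex \<Rightarrow> 'y) \<Rightarrow> complex) \<Rightarrow> bool" where
  "is_HKS S H ip \<equiv> rkhs H ip (schur_kernel S)"


section \<open>Output pairs and the interpolation problem\<close>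

text \<open>
  The resolvent in \<open>E(I - zT)\<^sup>-\<^sup>1x\<close> need not exist at every point of the disk, so the observability
  operator is given by the power series.
\<close>

definition observability ::
  "('x::complex_hilbert \<Rightarrow> 'y::complex_hilbert) \<Rightarrow> ('x \<Rightarrow> 'x) \<Rightarrow> 'x \<Rightarrow> complex \<Rightarrow> 'y" where
  "observability E T x = (\<lambda>z. if z \<in> \<D> then (\<Sum>n. z ^ n *\<^sub>C E ((T ^^ n) x)) else 0)"

definition analytic_output_pair ::
  "('x::complex_hilbert \<Rightarrow> 'y::complex_hilbert) \<Rightarrow> ('x \<Rightarrow> 'x) \<Rightarrow> bool" where
  "analytic_output_pair E T \<longleftrightarrow>
     (\<forall>x. (\<forall>z\<in>\<D>. summable (\<lambda>n. z ^ n *\<^sub>C E ((T ^^ n) x))) \<and> observability E T x \<in> Hol)"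

text \<open>Linearity of the observability operator is automatic for an analytic output pair.\<close>

definition output_stable ::
  "('x::complex_hilbert \<Rightarrow> 'y::complex_hilbert) \<Rightarrow> ('x \<Rightarrow> 'x) \<Rightarrow> bool" where
  "output_stable E T \<longleftrightarrow> analytic_output_pair E T \<and> (\<forall>x. observability E T x \<in> H2) \<and>
     (\<exists>C. \<forall>x. ip_norm H2_inner (observability E T x) \<le> C * norm x)"

text \<open>\<open>(E\<^sup>*f)\<^sup>\<and>\<^sup>L(T\<^sup>*)\<close>\<close>

definition left_eval ::
  "('x::complex_hilbert \<Rightarrow> 'y::complex_hilbert) \<Rightarrow> ('x \<Rightarrow> 'x) \<Rightarrow> (complex \<Rightarrow> 'y) \<Rightarrow> 'x" where
  "left_eval E T f = weak_suminf (\<lambda>n. (cadjoint T ^^ n) (cadjoint E (taylor_coeff f n)))"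

definition MFS ::
  "(complex \<Rightarrow> ('u::complex_hilbert \<Rightarrow>\<^sub>L 'y::complex_hilbert)) \<Rightarrow> ('x::complex_hilbert \<Rightarrow> 'x) \<Rightarrow>
   ('x \<Rightarrow> 'y) \<Rightarrow> ('x \<Rightarrow> 'u) \<Rightarrow> 'x \<Rightarrow> complex \<Rightarrow> 'y" where
  "MFS S T E N x = (\<lambda>z. observability E T x z - mult_op S (observability N T x) z)"

text \<open>
  Admissibility does not constrain the last component \<open>xx\<close> of the data set. In the last condition,
  \<open>P = M\<^sub>F\<^sup>[\<^sup>*\<^sup>]M\<^sub>F\<close>.
\<close>

definition AIP_admissible ::
  "(complex \<Rightarrow> 'y) set \<Rightarrow> ((complex \<Rightarrow> 'y) \<Rightarrow> (complex \<Rightarrow> 'y) \<Rightarrow> complex) \<Rightarrow>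
   (complex \<Rightarrow> ('u::complex_hilbert \<Rightarrow>\<^sub>L 'y::complex_hilbert)) \<Rightarrow> ('x::complex_hilbert \<Rightarrow> 'x) \<Rightarrow>
   ('x \<Rightarrow> 'y) \<Rightarrow> ('x \<Rightarrow> 'u) \<Rightarrow> 'x \<Rightarrow> bool" where
  "AIP_admissible H ip S T E N xx \<longleftrightarrow>
     schur_class S \<and> bounded_clinear T \<and> bounded_clinear E \<and> bounded_clinear N \<and>
     analytic_output_pair E T \<and> analytic_output_pair N T \<and>
     (\<forall>x. MFS S T E N x \<in> H) \<and>
     (let P = (\<lambda>x. adjoint_wrt ip (MFS S T E N) (MFS S T E N x))
      in \<forall>x. P x - cadjoint T (P (T x)) = cadjoint E (E x) - cadjoint N (N x))"

end

theory Submission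
  imports Defs
begin

text \<open>
  The space \<open>H\<^sup>2\<close> is identified with the square-summable sequences. Positivity of the kernel \<open>K\<^sub>S\<close>,
  which is implied by the existence of \<open>\<H>(K\<^sub>S)\<close>, says that \<open>s\<^sub>\<zeta> y \<mapsto> s\<^sub>\<zeta> S(\<zeta>)\<^sup>*y\<close> is contractive on
  the span of the Szego kernels \<open>s\<^sub>\<zeta> y\<close>; so multiplication by \<open>S\<close> is a contraction \<open>M\<^sub>S\<close> of \<open>H\<^sup>2\<close>.
  Density of that span and completeness of \<open>\<H>(K\<^sub>S)\<close> show that \<open>R = I - M\<^sub>S M\<^sub>S\<^sup>*\<close> maps \<open>H\<^sup>2\<close> into
  \<open>\<H>(K\<^sub>S) \<subseteq> H\<^sup>2\<close> and that \<open>\<langle>R f, g\<rangle>\<close> in \<open>\<H>(K\<^sub>S)\<close> equals \<open>\<langle>f, g\<rangle>\<close> in \<open>H\<^sup>2\<close>.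
  Let \<open>O\<close> be the observability operator of \<open>(E, T)\<close>. By the choice of \<open>N\<close>, that of \<open>(N, T)\<close> is
  \<open>M\<^sub>S\<^sup>* O\<close>, and so \<open>M\<^sub>F = R O\<close>. Hence the adjoint of \<open>M\<^sub>F\<close> in \<open>\<H>(K\<^sub>S)\<close> is
  the restriction of \<open>O\<^sup>*\<close>, and \<open>P = O\<^sup>* O - (M\<^sub>S\<^sup>* O)\<^sup>* (M\<^sub>S\<^sup>* O)\<close> satisfies the Stein equation because
  the coefficient sequence of \<open>O T x\<close> is that of \<open>O x\<close> without its first entry.
\<close>

section \<open>Complex inner products\<close>

lemma scaleC_zero_left [simp]: "0 *\<^sub>C x = (0::'a::complex_normed_vector)"
  by (metis norm_eq_zero norm_scaleC norm_zero mult_zero_left)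

lemma scaleC_zero_right [simp]: "c *\<^sub>C (0::'a::complex_normed_vector) = 0"
  by (metis norm_eq_zero norm_scaleC norm_zero mult_zero_right)

lemma scaleC_one [simp]: "1 *\<^sub>C x = (x::'a::complex_normed_vector)"
  using scaleC_of_real[of 1 x] by simp

lemma scaleC_minus_left: "(- c) *\<^sub>C x = - (c *\<^sub>C (x::'a::complex_normed_vector))"
  using scaleC_add_left[of "- c" c x] by (simp add: eq_neg_iff_add_eq_0)

lemma scaleC_minus_right: "c *\<^sub>C (- x) = - (c *\<^sub>C (x::'a::complex_normed_vector))"
  using scaleC_add_right[of c "- x" x] by (simp add: eq_neg_iff_add_eq_0)

lemma scaleC_diff_right: "c *\<^sub>C (x - y) = c *\<^sub>C x - c *\<^sub>C (y::'a::complex_normed_vector)"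
  using scaleC_add_right[of c x "- y"] by (simp add: scaleC_minus_right)

lemma bounded_bilinear_scaleC:
  "bounded_bilinear (\<lambda>c (x::'a::complex_normed_vector). c *\<^sub>C x)"
proof
  show "(r *\<^sub>R c) *\<^sub>C x = r *\<^sub>R c *\<^sub>C x" for r c and x :: 'a
    by (metis scaleC_of_real scaleC_scaleC scaleR_conv_of_real)
  show "c *\<^sub>C r *\<^sub>R x = r *\<^sub>R c *\<^sub>C x" for r c and x :: 'a
    by (metis scaleC_of_real scaleC_scaleC mult.commute)
  show "\<exists>K. \<forall>c (x::'a). norm (c *\<^sub>C x) \<le> norm c * norm x * K"
    by (rule exI[of _ 1]) (simp add: norm_scaleC)
qed (simp_all add: scaleC_add_left scaleC_add_right)

lemma cinner_add_right: "cinner x (y + z) = cinner x y + cinner (x::'a::complex_hilbert) z"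
  by (subst (1 2 3) cinner_commute) (simp add: cinner_add_left)

lemma cinner_scaleC_right: "cinner x (c *\<^sub>C y) = cnj c * cinner (x::'a::complex_hilbert) y"
  by (subst (1 2) cinner_commute) (simp add: cinner_scaleC_left)

lemma cinner_minus_left: "cinner (- x) y = - cinner (x::'a::complex_hilbert) y"
  using cinner_scaleC_left[of "-1" x y] by (simp add: scaleC_minus_left)

lemma cinner_minus_right: "cinner x (- y) = - cinner (x::'a::complex_hilbert) y"
  using cinner_scaleC_right[of x "-1" y] by (simp add: scaleC_minus_left)

lemma cinner_diff_left: "cinner (x - y) z = cinner x z - cinner (y::'a::complex_hilbert) z"
  using cinner_add_left[of x "- y" z] by (simp add: cinner_minus_left)

lemma cinner_diff_right: "cinner x (y - z) = cinner x y - cinner (x::'a::complex_hilbert) z"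
  using cinner_add_right[of x y "- z"] by (simp add: cinner_minus_right)

lemma cinner_zero_left [simp]: "cinner 0 x = 0"
  using cinner_scaleC_left[of 0 0 x] by simp

lemma cinner_zero_right [simp]: "cinner x 0 = 0"
  using cinner_scaleC_right[of x 0 0] by simp

lemma cinner_eq_0_iff: "cinner x x = 0 \<longleftrightarrow> x = (0::'a::complex_hilbert)"
  by (simp add: cinner_self)

lemma cinner_ext_left: "(\<And>v. cinner v x = cinner v y) \<Longrightarrow> x = (y::'a::complex_hilbert)"
  by (metis cinner_diff_right cinner_eq_0_iff right_minus_eq)

lemma cinner_ext_right: "(\<And>v. cinner x v = cinner y v) \<Longrightarrow> x = (y::'a::complex_hilbert)"
  by (metis cinner_diff_left cinner_eq_0_iff right_minus_eq)

lemma Re_cinner_self: "Re (cinner x x) = (norm (x::'a::complex_hilbert))\<^sup>2"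
  by (metis Re_complex_of_real cinner_self)

lemma norm_add_square:
  "(norm (x + y))\<^sup>2 = (norm x)\<^sup>2 + 2 * Re (cinner y x) + (norm (y::'a::complex_hilbert))\<^sup>2"
proof -
  have "cinner (x + y) (x + y) = cinner x x + (cinner y x + cinner x y) + cinner y y"
    by (simp add: cinner_add_left cinner_add_right)
  moreover have "Re (cinner x y) = Re (cinner y x)"
    by (subst cinner_commute) simp
  ultimately show ?thesis
    by (simp flip: Re_cinner_self)
qed

text \<open>The discriminant criterion: \<open>t\<close> is taken along \<open>- cnj c\<close>,
  which makes the quadratic real in one parameter \<open>s\<close>. It serves Cauchy--Schwarz in
  both kinds of inner product and, with \<open>A = 0\<close>, the variational step of the Riesz
  lemma.\<close>

lemma cmod_square_le_of_quadratic_nonneg: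
  fixes A B :: real
  assumes quad: "\<And>t. 0 \<le> A + 2 * Re (t * c) + (cmod t)\<^sup>2 * B" and "0 \<le> B"
  shows "(cmod c)\<^sup>2 \<le> A * B"
proof -
  have *: "0 \<le> A - 2 * s * (cmod c)\<^sup>2 + s\<^sup>2 * (cmod c)\<^sup>2 * B" for s :: real
  proof -
    have "Re (of_real (- s) * cnj c * c) = - s * (cmod c)\<^sup>2"
      unfolding cmod_power2 by (simp add: power2_eq_square algebra_simps)
    moreover have "(cmod (of_real (- s) * cnj c))\<^sup>2 = s\<^sup>2 * (cmod c)\<^sup>2"
      by (simp add: norm_mult power_mult_distrib)
    ultimately show ?thesis
      using quad[of "of_real (- s) * cnj c"] by simp
  qed
  show ?thesis
  proof (cases "B = 0")
    case True
    have "cmod c = 0"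
    proof (rule ccontr)
      assume "cmod c \<noteq> 0"
      \<comment> \<open>For \<open>B = 0\<close> this \<open>s\<close> gives the value
        \<open>A - (A + 1) = -1\<close>.\<close>
      then show False
        using *[of "(A + 1) / (2 * (cmod c)\<^sup>2)"] True by (simp add: field_simps)
    qed
    with True show ?thesis by simp
  next
    case False
    \<comment> \<open>For \<open>c\<close> nonzero, \<open>s = 1 / B\<close> is the minimum point;
      the value there is \<open>A - (cmod c)^2 / B\<close>.\<close>
    then show ?thesis
      using *[of "1 / B"] \<open>0 \<le> B\<close>
      by (simp add: field_simps power2_eq_square)
  qed
qed

lemma cmod_cinner_le: "cmod (cinner x y) \<le> norm x * norm (y::'a::complex_hilbert)"
proof -
  have "(cmod (cinner y x))\<^sup>2 \<le> (norm x)\<^sup>2 * (norm y)\<^sup>2"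
  proof (rule cmod_square_le_of_quadratic_nonneg)
    fix t
    show "0 \<le> (norm x)\<^sup>2 + 2 * Re (t * cinner y x) + (cmod t)\<^sup>2 * (norm y)\<^sup>2"
      using norm_add_square[of x "t *\<^sub>C y"] zero_le_power2[of "norm (x + t *\<^sub>C y)"]
      by (simp add: cinner_scaleC_left norm_scaleC power_mult_distrib)
  qed simp
  then have "cmod (cinner y x) \<le> norm x * norm y"
    unfolding power_mult_distrib[symmetric] by (rule power2_le_imp_le) simp
  then show ?thesis
    by (subst cinner_commute) simp
qed

lemma cinner_scaleR_left: "cinner (r *\<^sub>R x) y = r *\<^sub>R cinner x (y::'a::complex_hilbert)"
  using cinner_scaleC_left[of "of_real r" x y] by (simp add: scaleC_of_real scaleR_conv_of_real)

lemma cinner_scaleR_right: "cinner x (r *\<^sub>R y) = r *\<^sub>R cinner x (y::'a::complex_hilbert)"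
  using cinner_scaleC_right[of x "of_real r" y] by (simp add: scaleC_of_real scaleR_conv_of_real)

lemma bounded_bilinear_cinner: "bounded_bilinear (cinner :: 'a::complex_hilbert \<Rightarrow> _)"
proof
  show "\<exists>K. \<forall>x y::'a. norm (cinner x y) \<le> norm x * norm y * K"
    by (rule exI[of _ 1]) (simp add: cmod_cinner_le)
qed (simp_all add: cinner_add_left cinner_add_right cinner_scaleR_left cinner_scaleR_right)

lemmas tendsto_cinner = bounded_bilinear.tendsto[OF bounded_bilinear_cinner]
lemmas bounded_linear_cinner_left = bounded_bilinear.bounded_linear_left[OF bounded_bilinear_cinner]

lemma bounded_clinear_bounded_linear: "bounded_clinear A \<Longrightarrow> bounded_linear A"
  unfolding bounded_clinear_def by (rule conjunct1)

lemma bounded_clinear_scale: "bounded_clinear A \<Longrightarrow> A (c *\<^sub>C x) = c *\<^sub>C A x"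
  unfolding bounded_clinear_def by simp

lemma bounded_clinear_add: "bounded_clinear A \<Longrightarrow> A (x + y) = A x + A y"
  by (rule linear_add[OF bounded_linear.linear[OF bounded_clinear_bounded_linear]])

lemma bounded_clinearI:
  fixes A :: "'a::complex_normed_vector \<Rightarrow> 'b::complex_normed_vector"
  assumes "\<And>x y. A (x + y) = A x + A y" and scale: "\<And>c x. A (c *\<^sub>C x) = c *\<^sub>C A x"
    and "\<And>x. norm (A x) \<le> norm x * B"
  shows "bounded_clinear A"
  unfolding bounded_clinear_def
proof (intro conjI allI)
  show "bounded_linear A"
  proof (rule bounded_linear_intro)
    show "A (r *\<^sub>R x) = r *\<^sub>R A x" for r x
      using scale[of "of_real r" x] by (simp add: scaleC_of_real)
  qed (fact assms)+
qed (rule scale)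

lemma bounded_clinear_compose:
  "bounded_clinear A \<Longrightarrow> bounded_clinear B \<Longrightarrow> bounded_clinear (\<lambda>x. A (B x))"
  unfolding bounded_clinear_def using bounded_linear_compose[of A B] by simp

section \<open>Riesz representation and adjoints\<close>

text \<open>
  The functional is given by its graph \<open>\<Gamma>\<close>, on a subspace that need not be closed. Well-definedness
  is then part of the bound, and no extension to the closure is needed: the representing vector
  is the limit of any sequence that minimizes \<open>\<parallel>v\<parallel>\<^sup>2 - 2 Re c\<close> over \<open>\<Gamma>\<close>.
\<close>

lemma riesz_representation_graph:
  fixes \<Gamma> :: "('a::complex_hilbert \<times> complex) set"
  assumes ne: "\<Gamma> \<noteq> {}"
    and add: "\<And>v c w d. (v, c) \<in> \<Gamma> \<Longrightarrow> (w, d) \<in> \<Gamma> \<Longrightarrow> (v + w, c + d) \<in> \<Gamma>"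
    and scale: "\<And>v c t. (v, c) \<in> \<Gamma> \<Longrightarrow> (t *\<^sub>C v, t * c) \<in> \<Gamma>"
    and bound: "\<And>v c. (v, c) \<in> \<Gamma> \<Longrightarrow> cmod c \<le> B * norm v" and "0 \<le> B"
  obtains g where "g \<in> closure (fst ` \<Gamma>)" "norm g \<le> B" "\<And>v c. (v, c) \<in> \<Gamma> \<Longrightarrow> c = cinner v g"
proof -
  define J where "J = (\<lambda>p::'a \<times> complex. (norm (fst p))\<^sup>2 - 2 * Re (snd p))"
  define j where "j = Inf (J ` \<Gamma>)"
  have below: "- B\<^sup>2 \<le> J p" if "p \<in> \<Gamma>" for p
  proof -
    have "Re (snd p) \<le> B * norm (fst p)"
      using bound[of "fst p" "snd p"] that complex_Re_le_cmod[of "snd p"] by simp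
    moreover have "0 \<le> (norm (fst p) - B)\<^sup>2" by simp
    ultimately show ?thesis
      by (simp add: J_def power2_diff algebra_simps)
  qed
  then have bdd: "bdd_below (J ` \<Gamma>)"
    by (rule bdd_belowI2)
  have jle: "j \<le> J p" if "p \<in> \<Gamma>" for p
    using that bdd by (auto simp: j_def intro: cInf_lower)
  have "\<exists>p\<in>\<Gamma>. J p < j + e" if "e > 0" for e
    using cInf_lessD[of "J ` \<Gamma>" "j + e"] ne that by (auto simp: j_def)
  then have "\<forall>n. \<exists>p\<in>\<Gamma>. J p < j + 1 / real (Suc n)"
    by simp
  then obtain x where x: "\<And>n. x n \<in> \<Gamma>" "\<And>n. J (x n) < j + 1 / real (Suc n)"
    by metis
  define X where "X n = fst (x n)" for n
  define Y where "Y n = snd (x n)" for n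
  have XY: "(X n, Y n) \<in> \<Gamma>" for n
    using x(1)[of n] by (simp add: X_def Y_def)
  have JXY: "J (x n) = (norm (X n))\<^sup>2 - 2 * Re (Y n)" for n
    by (simp add: J_def X_def Y_def)
  have close: "(norm (X m - X n))\<^sup>2 \<le> 2 * (1 / real (Suc m) + 1 / real (Suc n))" for m n
  proof -
    \<comment> \<open>The midpoint lies in \<open>\<Gamma>\<close>, so its value is at least
      \<open>j\<close>; the parallelogram law then bounds the distance of two
      near-minimizers.\<close>
    have "j \<le> J ((1/2) *\<^sub>C (X m + X n), (1/2) * (Y m + Y n))"
      by (intro jle scale add XY)
    also have "\<dots> = (norm (X m + X n))\<^sup>2 / 4 - Re (Y m + Y n)"
      by (simp add: J_def norm_scaleC power_mult_distrib power_divide field_simps)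
    finally have "4 * j \<le> (norm (X m + X n))\<^sup>2 - 4 * Re (Y m) - 4 * Re (Y n)"
      by simp
    moreover have "(norm (X m - X n))\<^sup>2 + (norm (X m + X n))\<^sup>2 = 2 * (norm (X m))\<^sup>2 + 2 * (norm (X n))\<^sup>2"
      using norm_add_square[of "X m" "X n"] norm_add_square[of "X m" "- X n"]
      by (simp add: cinner_minus_left)
    ultimately show ?thesis
      using x(2)[of m] x(2)[of n] unfolding JXY distrib_left by linarith
  qed
  have "Cauchy X"
  proof (rule metric_CauchyI)
    fix e :: real assume "0 < e"
    \<comment> \<open>With this \<open>M\<close> both reciprocals are below \<open>e^2 / 4\<close>,
      so the bound in \<open>close\<close> is below \<open>e^2\<close>.\<close>
    then obtain M where M: "4 / e\<^sup>2 < real M"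
      using reals_Archimedean2 by blast
    show "\<exists>M. \<forall>m\<ge>M. \<forall>n\<ge>M. dist (X m) (X n) < e"
    proof (intro exI allI impI)
      fix m n assume "M \<le> m" "M \<le> n"
      then have "real M < real (Suc m)" "real M < real (Suc n)" by simp_all
      then have "4 / e\<^sup>2 < real (Suc m)" "4 / e\<^sup>2 < real (Suc n)"
        using M by linarith+
      then have "1 / real (Suc m) < e\<^sup>2 / 4" "1 / real (Suc n) < e\<^sup>2 / 4"
        using \<open>0 < e\<close> by (simp_all add: field_simps)
      then have "(norm (X m - X n))\<^sup>2 < e\<^sup>2"
        using close[of m n] by (simp only: distrib_left)
      then show "dist (X m) (X n) < e"
        using \<open>0 < e\<close> by (simp add: dist_norm power_less_imp_less_base)
    qed
  qed
  then obtain g where g: "X \<longlonglongrightarrow> g"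
    using Cauchy_convergent[of X] unfolding convergent_def by blast
  have rep: "c = cinner v g" if vc: "(v, c) \<in> \<Gamma>" for v c
  proof -
    \<comment> \<open>Perturbing \<open>X n\<close> by \<open>t *\<^sub>C v\<close> lowers
      \<open>J\<close> by at most \<open>1 / Suc n\<close>. In the limit a quadratic in
      \<open>t\<close> without constant term is nonnegative, so its linear coefficient
      vanishes.\<close>
    have "(cmod (cinner v g - c))\<^sup>2 \<le> 0 * (norm v)\<^sup>2"
    proof (rule cmod_square_le_of_quadratic_nonneg)
      fix t
      define f where "f n = 1 / real (Suc n) + 2 * Re (t * (cinner v (X n) - c)) + (cmod t)\<^sup>2 * (norm v)\<^sup>2" for n
      have "0 \<le> f n" for n
      proof -
        have "j \<le> J (X n + t *\<^sub>C v, Y n + t * c)"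
          by (intro jle add scale XY vc)
        also have "\<dots> = J (x n) + 2 * Re (t * (cinner v (X n) - c)) + (cmod t)\<^sup>2 * (norm v)\<^sup>2"
          unfolding JXY
          by (simp add: J_def norm_add_square cinner_scaleC_left norm_scaleC power_mult_distrib
              algebra_simps)
        finally show ?thesis
          using x(2)[of n] unfolding f_def by linarith
      qed
      moreover have "f \<longlonglongrightarrow> 0 + 2 * Re (t * (cinner v g - c)) + (cmod t)\<^sup>2 * (norm v)\<^sup>2"
        unfolding f_def
        by (intro tendsto_intros tendsto_cinner g LIMSEQ_Suc[OF lim_1_over_n])
      ultimately show "0 \<le> 0 + 2 * Re (t * (cinner v g - c)) + (cmod t)\<^sup>2 * (norm v)\<^sup>2"
        by (intro LIMSEQ_le_const) auto
    qed simp
    then show ?thesis by simp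
  qed
  \<comment> \<open>\<open>g\<close> need not belong to the domain of the functional, so the bound
    is applied at \<open>X n\<close> and carried to the limit.\<close>
  have "(\<lambda>n. cmod (cinner (X n) g)) \<longlonglongrightarrow> cmod (cinner g g)"
    by (intro tendsto_intros tendsto_cinner g)
  moreover have "(\<lambda>n. B * norm (X n)) \<longlonglongrightarrow> B * norm g"
    by (intro tendsto_intros g)
  moreover have "cmod (cinner (X n) g) \<le> B * norm (X n)" for n
    using bound[OF XY] rep[OF XY] by simp
  ultimately have "cmod (cinner g g) \<le> B * norm g"
    by (intro LIMSEQ_le) auto
  then have "norm g * norm g \<le> B * norm g"
    by (simp add: cinner_self power2_eq_square norm_mult)
  then have "norm g \<le> B"
    using \<open>0 \<le> B\<close> by (cases "norm g = 0") (auto simp: mult_le_cancel_right)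
  moreover have "g \<in> closure (fst ` \<Gamma>)"
    unfolding closure_sequential using g x(1) by (intro exI[of _ X]) (auto simp: X_def)
  ultimately show thesis
    using that rep by blast
qed

text \<open>Uniqueness comes from the inner product of the domain alone, so the same rule computes
  adjoints in the metric of \<open>H2\<close> and in that of \<open>H\<close>.\<close>

lemma adjoint_wrt_eqI:
  assumes "\<And>v. cinner v x = ip (A v) f"
  shows "adjoint_wrt ip A f = x"
  unfolding adjoint_wrt_def
proof (rule the_equality)
  show "y = x" if "\<forall>v. cinner v y = ip (A v) f" for y
    by (rule cinner_ext_left) (simp add: that assms)
qed (use assms in blast)

lemma bounded_clinear_norm_le:
  assumes "bounded_clinear A"
  obtains K where "0 \<le> K" "\<And>x. norm (A x) \<le> K * norm x"
proof -
  obtain K where "0 \<le> K" "\<And>x. norm (A x) \<le> norm x * K"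
    using bounded_linear.nonneg_bounded[OF bounded_clinear_bounded_linear[OF assms]] by blast
  then show thesis
    by (intro that[of K]) (simp_all add: mult.commute)
qed

text \<open>The description in \<open>adjoint_wrt\<close> is meaningful only if a representing
  vector exists; the Riesz lemma gives it for the graph of
  \<open>v \<mapsto> cinner (A v) f\<close>.\<close>

lemma cinner_cadjoint_right:
  fixes A :: "'a::complex_hilbert \<Rightarrow> 'b::complex_hilbert"
  assumes A: "bounded_clinear A"
  shows "cinner v (cadjoint A f) = cinner (A v) f"
proof -
  obtain K where K: "0 \<le> K" "\<And>x. norm (A x) \<le> K * norm x"
    using bounded_clinear_norm_le[OF A] by blast
  define \<Gamma> where "\<Gamma> = {(v, c). c = cinner (A v) f}"
  have "(0, cinner (A 0) f) \<in> \<Gamma>" by (simp add: \<Gamma>_def)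
  then have ne: "\<Gamma> \<noteq> {}" by blast
  have add: "(v + w, c + d) \<in> \<Gamma>" if "(v, c) \<in> \<Gamma>" "(w, d) \<in> \<Gamma>" for v c w d
    using that by (simp add: \<Gamma>_def bounded_clinear_add[OF A] cinner_add_left)
  have scale: "(t *\<^sub>C v, t * c) \<in> \<Gamma>" if "(v, c) \<in> \<Gamma>" for v c t
    using that by (simp add: \<Gamma>_def bounded_clinear_scale[OF A] cinner_scaleC_left)
  have bound: "cmod c \<le> K * norm f * norm v" if "(v, c) \<in> \<Gamma>" for v c
    using cmod_cinner_le[of "A v" f] mult_right_mono[OF K(2)[of v] norm_ge_zero[of f]] that
    by (simp add: \<Gamma>_def ac_simps)
  have "0 \<le> K * norm f" using K(1) by simp
  then obtain g where g: "\<And>v c. (v, c) \<in> \<Gamma> \<Longrightarrow> c = cinner v g"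
    using riesz_representation_graph[OF ne add scale bound] by metis
  have "cinner v g = cinner (A v) f" for v
    using g[of v "cinner (A v) f"] by (simp add: \<Gamma>_def)
  then have "cadjoint A f = g"
    by (rule adjoint_wrt_eqI)
  with \<open>cinner v g = cinner (A v) f\<close> show ?thesis
    by simp
qed

lemma cinner_cadjoint_left:
  fixes A :: "'a::complex_hilbert \<Rightarrow> 'b::complex_hilbert"
  assumes "bounded_clinear A"
  shows "cinner (cadjoint A f) v = cinner f (A v)"
proof -
  have "cinner (cadjoint A f) v = cnj (cinner v (cadjoint A f))" by (rule cinner_commute)
  also have "\<dots> = cinner f (A v)"
    unfolding cinner_cadjoint_right[OF assms] by (rule cinner_commute[symmetric])
  finally show ?thesis .
qed

text \<open>Test the adjoint relation on \<open>cadjoint A f\<close> itself and cancel one factor of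
  its norm.\<close>

lemma norm_cadjoint_le:
  fixes A :: "'a::complex_hilbert \<Rightarrow> 'b::complex_hilbert"
  assumes A: "bounded_clinear A" and K: "\<And>x. norm (A x) \<le> K * norm x" and "0 \<le> K"
  shows "norm (cadjoint A f) \<le> K * norm f"
proof -
  let ?g = "cadjoint A f"
  have "(norm ?g)\<^sup>2 = cmod (cinner (A ?g) f)"
    unfolding cinner_cadjoint_right[OF A, symmetric] cinner_self by (simp only: norm_of_real) simp
  also have "\<dots> \<le> K * norm ?g * norm f"
    by (rule order_trans[OF cmod_cinner_le mult_right_mono[OF K]]) simp
  finally have "norm ?g * norm ?g \<le> (K * norm f) * norm ?g"
    by (simp add: power2_eq_square ac_simps)
  moreover have "0 \<le> K * norm f"
    using \<open>0 \<le> K\<close> by simp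
  ultimately show ?thesis
    by (cases "?g = 0") (simp_all add: mult_le_cancel_right)
qed

lemma bounded_clinear_cadjoint:
  fixes A :: "'a::complex_hilbert \<Rightarrow> 'b::complex_hilbert"
  assumes A: "bounded_clinear A"
  shows "bounded_clinear (cadjoint A)"
proof -
  obtain K where K: "0 \<le> K" "\<And>x. norm (A x) \<le> K * norm x"
    using bounded_clinear_norm_le[OF A] by blast
  show ?thesis
  proof (rule bounded_clinearI)
    show "norm (cadjoint A f) \<le> norm f * K" for f
      using norm_cadjoint_le[OF A K(2,1)] by (simp add: mult.commute)
    show "cadjoint A (f + g) = cadjoint A f + cadjoint A g" for f g
      by (rule cinner_ext_left) (simp only: cinner_cadjoint_right[OF A] cinner_add_right)
    show "cadjoint A (c *\<^sub>C f) = c *\<^sub>C cadjoint A f" for c f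
      by (rule cinner_ext_left) (simp only: cinner_cadjoint_right[OF A] cinner_scaleC_right)
  qed
qed

lemma cinner_cadjoint_funpow:
  fixes A :: "'a::complex_hilbert \<Rightarrow> 'a"
  assumes "bounded_clinear A"
  shows "cinner ((cadjoint A ^^ n) f) v = cinner f ((A ^^ n) v)"
proof (induction n arbitrary: v)
  case (Suc n)
  have "cinner ((cadjoint A ^^ Suc n) f) v = cinner ((cadjoint A ^^ n) f) (A v)"
    by (simp add: cinner_cadjoint_left[OF assms])
  also have "\<dots> = cinner f ((A ^^ n) (A v))"
    by (rule Suc)
  finally show ?case
    unfolding funpow_Suc_right comp_def .
qed simp

lemma weak_suminf_eq:
  assumes "weak_sums g w"
  shows "weak_suminf g = w"
  unfolding weak_suminf_def
proof (rule the_equality)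
  show "x = w" if "weak_sums g x" for x
  proof (rule cinner_ext_right)
    show "cinner x v = cinner w v" for v
      using assms that sums_unique2 unfolding weak_sums_def by blast
  qed
qed (rule assms)

section \<open>Power series with vector coefficients\<close>

lemma summable_powser:
  fixes a :: "nat \<Rightarrow> 'a::{complex_normed_vector,banach}"
  assumes "\<And>n. norm (a n) \<le> M" "z \<in> \<D>"
  shows "summable (\<lambda>n. z ^ n *\<^sub>C a n)"
proof (rule summable_comparison_test')
  show "summable (\<lambda>n. cmod z ^ n * M)"
    using assms(2) by (intro summable_mult2 summable_geometric) simp
  show "norm (z ^ n *\<^sub>C a n) \<le> cmod z ^ n * M" for n
    using assms(1)[of n] by (simp add: norm_scaleC norm_power mult_left_mono)
qed

text \<open>Termwise differentiation on a smaller disk of radius \<open>r\<close>, where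
  \<open>n * r^(n - 1) * M\<close> dominates the differentiated series.\<close>

lemma vholomorphic_on_powser:
  fixes a :: "nat \<Rightarrow> 'a::{complex_normed_vector,banach}"
  assumes bound: "\<And>n. norm (a n) \<le> M"
    and f: "\<And>z. z \<in> \<D> \<Longrightarrow> (\<lambda>n. z ^ n *\<^sub>C a n) sums f z"
  shows "vholomorphic_on f \<D>"
  unfolding vholomorphic_on_def
proof
  fix z :: complex assume "z \<in> \<D>"
  then have "cmod z < 1" by simp
  then obtain r where r: "cmod z < r" "r < 1"
    using dense by blast
  then have "0 < r"
    using norm_ge_zero[of z] by linarith
  define d where "d n w = (of_nat n * w ^ (n - 1)) *\<^sub>C a n" for n and w :: complex
  define D where "D w = (\<Sum>n. d n w)" for w
  have "uniform_limit (ball 0 r) (\<lambda>n w. \<Sum>i<n. d i w) D sequentially"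
    unfolding D_def
  proof (rule Weierstrass_m_test)
    show "norm (d n w) \<le> of_nat n * r ^ (n - 1) * M" if "w \<in> ball 0 r" for n w
    proof -
      have "cmod w ^ (n - 1) \<le> r ^ (n - 1)"
        using that by (intro power_mono) simp_all
      then show ?thesis
        unfolding d_def norm_scaleC norm_mult norm_power norm_of_nat
        using bound[of n] \<open>0 < r\<close> by (intro mult_mono) simp_all
    qed
    have "summable (\<lambda>n. of_nat (Suc n) * r ^ n)"
      using geometric_deriv_sums[of r] \<open>0 < r\<close> \<open>r < 1\<close> by (simp add: sums_iff)
    then have "summable (\<lambda>n. of_nat n * r ^ (n - 1))"
      by (subst summable_Suc_iff[symmetric]) simp
    then show "summable (\<lambda>n. of_nat n * r ^ (n - 1) * M)"
      by (rule summable_mult2)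
  qed
  then have unif: "\<forall>\<^sub>F n in sequentially. \<forall>w\<in>ball 0 r. norm ((\<Sum>i<n. d i w) - D w) < e" if "0 < e" for e
    using that by (simp add: uniform_limit_iff dist_norm)
  have "\<exists>g. \<forall>w\<in>ball 0 r. (\<lambda>n. w ^ n *\<^sub>C a n) sums g w \<and>
      (g has_derivative (\<lambda>h. h *\<^sub>C D w)) (at w within ball 0 r)"
  proof (rule has_derivative_series)
    fix n and w :: complex
    have "((\<lambda>w. w ^ n) has_derivative (\<lambda>h. of_nat n * h * w ^ (n - 1))) (at w within ball 0 r)"
      by (rule has_derivative_power[OF has_derivative_ident])
    then have "((\<lambda>w. w ^ n *\<^sub>C a n) has_derivative (\<lambda>h. (of_nat n * h * w ^ (n - 1)) *\<^sub>C a n))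
        (at w within ball 0 r)"
      by (rule bounded_linear.has_derivative[OF bounded_bilinear.bounded_linear_left[OF
              bounded_bilinear_scaleC]])
    moreover have "(of_nat n * h * w ^ (n - 1)) *\<^sub>C a n = h *\<^sub>C d n w" for h
      by (simp add: d_def scaleC_scaleC ac_simps)
    ultimately show "((\<lambda>w. w ^ n *\<^sub>C a n) has_derivative (\<lambda>h. h *\<^sub>C d n w)) (at w within ball 0 r)"
      by simp
  next
    fix e :: real assume "0 < e"
    show "\<forall>\<^sub>F n in sequentially. \<forall>w\<in>ball 0 r. \<forall>h.
        norm ((\<Sum>i<n. h *\<^sub>C d i w) - h *\<^sub>C D w) \<le> e * norm h"
      using unif[OF \<open>0 < e\<close>]
    proof (rule eventually_mono, intro ballI allI)
      fix n and w h :: complex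
      assume "\<forall>w\<in>ball 0 r. norm ((\<Sum>i<n. d i w) - D w) < e" "w \<in> ball 0 r"
      then have "norm ((\<Sum>i<n. d i w) - D w) \<le> e"
        by (simp add: less_imp_le)
      moreover have "(\<Sum>i<n. h *\<^sub>C d i w) - h *\<^sub>C D w = h *\<^sub>C ((\<Sum>i<n. d i w) - D w)"
        by (simp add: scaleC_diff_right bounded_bilinear.sum_right[OF bounded_bilinear_scaleC])
      ultimately show "norm ((\<Sum>i<n. h *\<^sub>C d i w) - h *\<^sub>C D w) \<le> e * norm h"
        by (simp add: norm_scaleC mult.commute[of e] mult_left_mono)
    qed
  next
    show "(\<lambda>n. z ^ n *\<^sub>C a n) sums f z"
      by (rule f[OF \<open>z \<in> \<D>\<close>])
    show "z \<in> ball 0 r" using r by simp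
  qed simp
  then obtain g where g: "\<And>w. w \<in> ball 0 r \<Longrightarrow> (\<lambda>n. w ^ n *\<^sub>C a n) sums g w"
    "\<And>w. w \<in> ball 0 r \<Longrightarrow> (g has_derivative (\<lambda>h. h *\<^sub>C D w)) (at w within ball 0 r)"
    by blast
  \<comment> \<open>The theorem on series of derivatives yields a sum function \<open>g\<close> of
    its own, characterized on the small ball only; it has to be matched with \<open>f\<close>
    there.\<close>
  have eq: "g w = f w" if "w \<in> ball 0 r" for w
  proof (rule sums_unique2[OF g(1)[OF that] f])
    show "w \<in> \<D>" using that \<open>r < 1\<close> by simp
  qed
  have z: "z \<in> ball 0 r" using r by simp
  have "(g has_derivative (\<lambda>h. h *\<^sub>C D z)) (at z)"
    using g(2)[OF z] unfolding at_within_open[OF z open_ball] .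
  then have "(f has_derivative (\<lambda>h. h *\<^sub>C D z)) (at z)"
    by (rule has_derivative_transform_within_open[OF _ open_ball z eq])
  then have "(f has_derivative (\<lambda>h. h *\<^sub>C D z)) (at z within \<D>)"
    by (rule has_derivative_at_withinI)
  then show "\<exists>f'. (f has_derivative (\<lambda>h. h *\<^sub>C f')) (at z within \<D>)" ..
qed

lemma powser_sums_0_imp_coeff_0:
  fixes c :: "nat \<Rightarrow> complex"
  assumes "\<And>z. z \<in> \<D> \<Longrightarrow> (\<lambda>n. c n * z ^ n) sums 0"
  shows "c n = 0"
proof (induction n rule: less_induct)
  case (less n)
  \<comment> \<open>By induction the coefficients below \<open>n\<close> vanish, so the series
    divided by \<open>z^n\<close> still sums to 0 off the origin, while its limit at 0 is
    \<open>c n\<close>.\<close>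
  have "((\<lambda>z::complex. 0) \<longlongrightarrow> (\<lambda>k. c (k + n)) 0) (at 0)"
  proof (rule powser_limit_0_strong[where s = 1])
    fix z :: complex assume z: "z \<noteq> 0" "cmod z < 1"
    then have "(\<lambda>k. c (k + n) * z ^ (k + n)) sums (0 - (\<Sum>k<n. c k * z ^ k))"
      by (intro sums_split_initial_segment assms) simp
    then have "(\<lambda>k. c (k + n) * z ^ (k + n) / z ^ n) sums (0 / z ^ n)"
      using less by (intro sums_divide) simp
    then show "(\<lambda>k. c (k + n) * z ^ k) sums 0"
      using z by (simp add: power_add)
  qed simp
  then show ?case
    using tendsto_const_iff[of "at (0::complex)" 0 "c n"] by simp
qed

text \<open>Pairing with a fixed vector reduces this to scalar coefficients.\<close>

lemma powser_coeff_unique: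
  fixes a b :: "nat \<Rightarrow> 'a::complex_hilbert"
  assumes "\<And>z. z \<in> \<D> \<Longrightarrow> (\<lambda>n. z ^ n *\<^sub>C a n) sums f z"
    and "\<And>z. z \<in> \<D> \<Longrightarrow> (\<lambda>n. z ^ n *\<^sub>C b n) sums f z"
  shows "a = b"
proof
  fix n
  show "a n = b n"
  proof (rule cinner_ext_right)
    fix y
    have "cinner (a n - b n) y = 0"
    proof (rule powser_sums_0_imp_coeff_0)
      fix z :: complex assume "z \<in> \<D>"
      then have "(\<lambda>n. z ^ n *\<^sub>C a n - z ^ n *\<^sub>C b n) sums (f z - f z)"
        by (intro sums_diff assms)
      then have "(\<lambda>n. cinner (z ^ n *\<^sub>C a n - z ^ n *\<^sub>C b n) y) sums cinner (f z - f z) y"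
        by (rule bounded_linear.sums[OF bounded_linear_cinner_left])
      then show "(\<lambda>n. cinner (a n - b n) y * z ^ n) sums 0"
        by (simp add: cinner_diff_left cinner_scaleC_left algebra_simps)
    qed
    then show "cinner (a n) y = cinner (b n) y"
      by (simp add: cinner_diff_left)
  qed
qed

lemma taylor_coeff_eqI:
  fixes a :: "nat \<Rightarrow> 'a::complex_hilbert"
  assumes "\<And>z. z \<in> \<D> \<Longrightarrow> (\<lambda>n. z ^ n *\<^sub>C a n) sums f z"
  shows "taylor_coeff f = a"
  unfolding taylor_coeff_def
proof (rule the_equality)
  show "b = a" if "\<forall>z\<in>\<D>. (\<lambda>n. z ^ n *\<^sub>C b n) sums f z" for b
    using that assms by (intro powser_coeff_unique[of b f a]) blast+
qed (use assms in blast)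

section \<open>Square-summable sequences\<close>

text \<open>A type in place of the set \<open>H2\<close>, so that it can be made an instance of
  \<open>complex_hilbert\<close>; the Riesz lemma and \<open>cadjoint\<close> then apply to
  it.\<close>

typedef (overloaded) ('a::complex_hilbert) ell2 =
    "{a :: nat \<Rightarrow> 'a. summable (\<lambda>n. (norm (a n))\<^sup>2)}"
  morphisms ell2_nth Abs_ell2
  by (rule exI[of _ "\<lambda>_. 0"]) simp

lemma summable_ell2: "summable (\<lambda>n. (norm (ell2_nth a n))\<^sup>2)"
  using ell2_nth[of a] by simp

lemma ell2_nth_Abs: "summable (\<lambda>n. (norm (a n))\<^sup>2) \<Longrightarrow> ell2_nth (Abs_ell2 a) = a"
  by (rule Abs_ell2_inverse) simp

lemma ell2_eqI: "(\<And>n. ell2_nth a n = ell2_nth b n) \<Longrightarrow> a = b"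
  by (metis ell2_nth_inject ext)

lemma summable_norm_square_add:
  fixes a b :: "nat \<Rightarrow> 'a::real_normed_vector"
  assumes "summable (\<lambda>n. (norm (a n))\<^sup>2)" "summable (\<lambda>n. (norm (b n))\<^sup>2)"
  shows "summable (\<lambda>n. (norm (a n + b n))\<^sup>2)"
proof (rule summable_comparison_test')
  show "summable (\<lambda>n. 2 * (norm (a n))\<^sup>2 + 2 * (norm (b n))\<^sup>2)"
    by (intro summable_add summable_mult assms)
  fix n
  have "(norm (a n + b n))\<^sup>2 \<le> (norm (a n) + norm (b n))\<^sup>2"
    by (intro power_mono norm_triangle_ineq) simp
  also have "\<dots> \<le> 2 * (norm (a n))\<^sup>2 + 2 * (norm (b n))\<^sup>2"
    using zero_le_power2[of "norm (a n) - norm (b n)"] by (simp add: power2_sum power2_diff)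
  finally show "norm ((norm (a n + b n))\<^sup>2) \<le> 2 * (norm (a n))\<^sup>2 + 2 * (norm (b n))\<^sup>2"
    by simp
qed

lemma summable_norm_square_scaleC:
  fixes a :: "nat \<Rightarrow> 'a::complex_normed_vector"
  assumes "summable (\<lambda>n. (norm (a n))\<^sup>2)"
  shows "summable (\<lambda>n. (norm (c *\<^sub>C a n))\<^sup>2)"
  unfolding norm_scaleC power_mult_distrib by (intro summable_mult assms)

text \<open>Minkowski's inequality for finite sums, \<open>L2_set_triangle_ineq\<close>, bounds
  every partial sum.\<close>

lemma sqrt_suminf_norm_square_triangle:
  fixes a b :: "nat \<Rightarrow> 'a::real_normed_vector"
  assumes a: "summable (\<lambda>n. (norm (a n))\<^sup>2)" and b: "summable (\<lambda>n. (norm (b n))\<^sup>2)"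
  shows "sqrt (\<Sum>n. (norm (a n + b n))\<^sup>2) \<le> sqrt (\<Sum>n. (norm (a n))\<^sup>2) + sqrt (\<Sum>n. (norm (b n))\<^sup>2)"
proof (rule real_le_lsqrt)
  let ?x = "sqrt (\<Sum>n. (norm (a n))\<^sup>2)" and ?y = "sqrt (\<Sum>n. (norm (b n))\<^sup>2)"
  show "0 \<le> ?x + ?y"
    by (intro add_nonneg_nonneg real_sqrt_ge_zero suminf_nonneg a b) simp_all
  show "(\<Sum>n. (norm (a n + b n))\<^sup>2) \<le> (?x + ?y)\<^sup>2"
  proof (rule suminf_le_const[OF summable_norm_square_add[OF a b]])
    fix N
    let ?f = "\<lambda>n. norm (a n)" and ?g = "\<lambda>n. norm (b n)"
    have "(\<Sum>n<N. (norm (a n + b n))\<^sup>2) \<le> (\<Sum>n<N. (?f n + ?g n)\<^sup>2)"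
      by (intro sum_mono power_mono norm_triangle_ineq) simp
    also have "\<dots> = (L2_set (\<lambda>n. ?f n + ?g n) {..<N})\<^sup>2"
      by (simp add: L2_set_def sum_nonneg)
    also have "\<dots> \<le> (L2_set ?f {..<N} + L2_set ?g {..<N})\<^sup>2"
      by (intro power_mono L2_set_triangle_ineq L2_set_nonneg)
    also have "\<dots> \<le> (?x + ?y)\<^sup>2"
      unfolding L2_set_def
      by (intro power_mono add_mono real_sqrt_le_mono sum_le_suminf a b add_nonneg_nonneg
          real_sqrt_ge_zero sum_nonneg) simp_all
    finally show "(\<Sum>n<N. (norm (a n + b n))\<^sup>2) \<le> (?x + ?y)\<^sup>2" .
  qed
qed

instantiation ell2 :: (complex_hilbert) complex_normed_vector
begin

definition "0 = Abs_ell2 (\<lambda>_. 0)"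
definition "a + b = Abs_ell2 (\<lambda>n. ell2_nth a n + ell2_nth b n)"
definition "c *\<^sub>C a = Abs_ell2 (\<lambda>n. c *\<^sub>C ell2_nth a n)"
definition "r *\<^sub>R a = complex_of_real r *\<^sub>C (a :: 'a ell2)"
definition "- a = (-1) *\<^sub>C (a :: 'a ell2)"
definition "a - b = a + - (b :: 'a ell2)"
definition norm_ell2_def: "norm a = sqrt (\<Sum>n. (norm (ell2_nth a n))\<^sup>2)"
definition "sgn a = inverse (norm a) *\<^sub>R (a :: 'a ell2)"
definition "dist a b = norm (a - b :: 'a ell2)"
definition "(uniformity :: ('a ell2 \<times> 'a ell2) filter) = (INF e\<in>{0<..}. principal {(a, b). dist a b < e})"
definition "open (U :: 'a ell2 set) \<longleftrightarrow> (\<forall>a\<in>U. \<forall>\<^sub>F (a', b) in uniformity. a' = a \<longrightarrow> b \<in> U)"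

lemma ell2_nth_0 [simp]: "ell2_nth 0 n = 0"
  by (simp add: zero_ell2_def ell2_nth_Abs)

lemma ell2_nth_add [simp]: "ell2_nth (a + b) n = ell2_nth a n + ell2_nth b n"
  by (simp add: plus_ell2_def ell2_nth_Abs summable_norm_square_add summable_ell2)

lemma ell2_nth_scaleC [simp]: "ell2_nth (c *\<^sub>C a) n = c *\<^sub>C ell2_nth a n"
  by (simp add: scaleC_ell2_def ell2_nth_Abs summable_norm_square_scaleC summable_ell2)

lemma ell2_nth_scaleR [simp]: "ell2_nth (r *\<^sub>R a) n = r *\<^sub>R ell2_nth a n"
  by (simp add: scaleR_ell2_def scaleC_of_real)

lemma ell2_nth_minus [simp]: "ell2_nth (- a) n = - ell2_nth a n"
  by (simp add: uminus_ell2_def scaleC_minus_left)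

lemma ell2_nth_diff [simp]: "ell2_nth (a - b) n = ell2_nth a n - ell2_nth b n"
  by (simp add: minus_ell2_def)

lemma norm_ell2_square: "(norm a)\<^sup>2 = (\<Sum>n. (norm (ell2_nth a n))\<^sup>2)"
  by (simp add: norm_ell2_def suminf_nonneg summable_ell2)

lemma sum_le_norm_ell2: "finite A \<Longrightarrow> (\<Sum>n\<in>A. (norm (ell2_nth a n))\<^sup>2) \<le> (norm a)\<^sup>2"
  unfolding norm_ell2_square by (intro sum_le_suminf summable_ell2) simp_all

lemma norm_ell2_nth_le: "norm (ell2_nth a n) \<le> norm a"
proof (rule power2_le_imp_le)
  show "(norm (ell2_nth a n))\<^sup>2 \<le> (norm a)\<^sup>2"
    using sum_le_norm_ell2[of "{n}" a] by simp
  show "0 \<le> norm a"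
    unfolding norm_ell2_def by (intro real_sqrt_ge_zero suminf_nonneg summable_ell2) simp
qed

instance
proof
  fix a b c :: "'a ell2" and r s :: real and t u :: complex
  show "a + b + c = a + (b + c)" "a + b = b + a" "0 + a = a" "- a + a = 0" "a - b = a + - b"
    "r *\<^sub>R (a + b) = r *\<^sub>R a + r *\<^sub>R b" "(r + s) *\<^sub>R a = r *\<^sub>R a + s *\<^sub>R a"
    "r *\<^sub>R s *\<^sub>R a = (r * s) *\<^sub>R a" "1 *\<^sub>R a = a"
    "t *\<^sub>C (a + b) = t *\<^sub>C a + t *\<^sub>C b" "(t + u) *\<^sub>C a = t *\<^sub>C a + u *\<^sub>C a"
    "t *\<^sub>C u *\<^sub>C a = (t * u) *\<^sub>C a" "complex_of_real r *\<^sub>C a = r *\<^sub>R a"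
    by (rule ell2_eqI, simp add: algebra_simps scaleC_add_right scaleC_add_left scaleC_scaleC
        scaleC_of_real)+
  show "norm a = 0 \<longleftrightarrow> a = 0"
  proof
    assume "norm a = 0"
    then have "norm (ell2_nth a n) \<le> 0" for n
      using norm_ell2_nth_le[of a n] by simp
    then show "a = 0"
      by (intro ell2_eqI) simp
  qed (simp add: norm_ell2_def)
  show "norm (a + b) \<le> norm a + norm b"
    using sqrt_suminf_norm_square_triangle[OF summable_ell2[of a] summable_ell2[of b]]
    by (simp add: norm_ell2_def)
  show scale: "norm (t *\<^sub>C a) = cmod t * norm a" for t
    by (simp add: norm_ell2_def norm_scaleC power_mult_distrib suminf_mult summable_ell2
        real_sqrt_mult)
  show "norm (r *\<^sub>R a) = \<bar>r\<bar> * norm a"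
    unfolding scaleR_ell2_def scale by simp
qed (simp_all add: sgn_ell2_def dist_ell2_def uniformity_ell2_def open_ell2_def)

end

text \<open>Partial sums are continuous in the coordinates, so a bound in this form survives
  coordinatewise limits; the proof of completeness uses it that way.\<close>

lemma ell2_eq_of_partial_sums_le:
  fixes a :: "nat \<Rightarrow> 'a::complex_hilbert"
  assumes le: "\<And>N. (\<Sum>n<N. (norm (a n))\<^sup>2) \<le> K\<^sup>2" and "0 \<le> K"
  shows "summable (\<lambda>n. (norm (a n))\<^sup>2)" "norm (Abs_ell2 a) \<le> K"
proof -
  show summable: "summable (\<lambda>n. (norm (a n))\<^sup>2)"
    using le by (intro summableI_nonneg_bounded[of _ "K\<^sup>2"]) simp_all
  have "(\<Sum>n. (norm (a n))\<^sup>2) \<le> K\<^sup>2"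
    by (rule suminf_le_const[OF summable le])
  then show "norm (Abs_ell2 a) \<le> K"
    using \<open>0 \<le> K\<close> by (simp add: norm_ell2_def ell2_nth_Abs[OF summable] real_le_lsqrt)
qed

lemma summable_cinner_ell2:
  "summable (\<lambda>n. cinner (ell2_nth a n) (ell2_nth b n))"
proof (rule summable_comparison_test')
  show "summable (\<lambda>n. (norm (ell2_nth a n))\<^sup>2 + (norm (ell2_nth b n))\<^sup>2)"
    by (intro summable_add summable_ell2)
  fix n
  let ?x = "norm (ell2_nth a n)" and ?y = "norm (ell2_nth b n)"
  have "?x * ?y \<le> ?x\<^sup>2 + ?y\<^sup>2"
    using sum_squares_bound[of ?x ?y] mult_nonneg_nonneg[OF norm_ge_zero norm_ge_zero,
        of "ell2_nth a n" "ell2_nth b n"] by linarith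
  then show "cmod (cinner (ell2_nth a n) (ell2_nth b n)) \<le> ?x\<^sup>2 + ?y\<^sup>2"
    by (rule order_trans[OF cmod_cinner_le])
qed

instantiation ell2 :: (complex_hilbert) complex_hilbert
begin

definition cinner_ell2_def: "cinner a b = (\<Sum>n. cinner (ell2_nth a n) (ell2_nth b n))"

instance
proof
  fix a b c :: "'a ell2" and t :: complex
  have "cnj (cinner b a) = (\<Sum>n. cnj (cinner (ell2_nth b n) (ell2_nth a n)))"
    unfolding cinner_ell2_def
    by (rule bounded_linear.suminf[OF bounded_linear_cnj summable_cinner_ell2])
  then show "cinner a b = cnj (cinner b a)"
    unfolding cinner_ell2_def by (simp add: cinner_commute[symmetric])
  show "cinner (a + b) c = cinner a c + cinner b c"
    unfolding cinner_ell2_def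
    by (simp add: cinner_add_left suminf_add[OF summable_cinner_ell2 summable_cinner_ell2])
  show "cinner (t *\<^sub>C a) b = t * cinner a b"
    unfolding cinner_ell2_def
    by (simp add: cinner_scaleC_left suminf_mult[OF summable_cinner_ell2])
  show "cinner a a = complex_of_real ((norm a)\<^sup>2)"
    unfolding cinner_ell2_def norm_ell2_square cinner_self
    by (rule suminf_of_real[OF summable_ell2, symmetric])
next
  fix X :: "nat \<Rightarrow> 'a ell2"
  assume X: "Cauchy X"
  have "Cauchy (\<lambda>k. ell2_nth (X k) n)" for n
  proof (rule metric_CauchyI)
    fix e :: real assume "0 < e"
    then obtain M where "\<forall>m\<ge>M. \<forall>k\<ge>M. dist (X m) (X k) < e"
      using metric_CauchyD[OF X] by blast
    moreover have "dist (ell2_nth (X m) n) (ell2_nth (X k) n) \<le> dist (X m) (X k)" for m k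
      using norm_ell2_nth_le[of "X m - X k" n] by (simp add: dist_norm)
    ultimately show "\<exists>M. \<forall>m\<ge>M. \<forall>k\<ge>M. dist (ell2_nth (X m) n) (ell2_nth (X k) n) < e"
      by (meson le_less_trans)
  qed
  then have "\<forall>n. \<exists>l. (\<lambda>k. ell2_nth (X k) n) \<longlonglongrightarrow> l"
    using Cauchy_convergent unfolding convergent_def by blast
  then obtain l where l: "\<And>n. (\<lambda>k. ell2_nth (X k) n) \<longlonglongrightarrow> l n"
    by metis
  have close: "\<exists>M. \<forall>m\<ge>M. summable (\<lambda>n. (norm (ell2_nth (X m) n - l n))\<^sup>2) \<and>
      norm (Abs_ell2 (\<lambda>n. ell2_nth (X m) n - l n)) \<le> e" if "0 < e" for e
  proof -
    obtain M where M: "\<And>m k. m \<ge> M \<Longrightarrow> k \<ge> M \<Longrightarrow> dist (X m) (X k) < e"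
      using metric_CauchyD[OF X \<open>0 < e\<close>] by blast
    \<comment> \<open>The Cauchy estimate with \<open>m\<close> fixed and \<open>k\<close> tending
      to infinity, taken in finite partial sums.\<close>
    have "(\<Sum>n<N. (norm (ell2_nth (X m) n - l n))\<^sup>2) \<le> e\<^sup>2" if "m \<ge> M" for m N
    proof (rule tendsto_upperbound)
      show "(\<lambda>k. \<Sum>n<N. (norm (ell2_nth (X m) n - ell2_nth (X k) n))\<^sup>2)
          \<longlonglongrightarrow> (\<Sum>n<N. (norm (ell2_nth (X m) n - l n))\<^sup>2)"
        by (intro tendsto_intros l)
      have "(\<Sum>n<N. (norm (ell2_nth (X m) n - ell2_nth (X k) n))\<^sup>2) \<le> e\<^sup>2" if "k \<ge> M" for k
      proof -
        have "(norm (X m - X k))\<^sup>2 \<le> e\<^sup>2"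
          using M[OF \<open>m \<ge> M\<close> that] by (intro power_mono) (simp_all add: dist_norm)
        then show ?thesis
          using sum_le_norm_ell2[of "{..<N}" "X m - X k"] by simp
      qed
      then show "\<forall>\<^sub>F k in sequentially. (\<Sum>n<N. (norm (ell2_nth (X m) n - ell2_nth (X k) n))\<^sup>2) \<le> e\<^sup>2"
        unfolding eventually_sequentially by blast
    qed simp
    then show ?thesis
      using ell2_eq_of_partial_sums_le[of "\<lambda>n. ell2_nth (X m) n - l n" e for m] \<open>0 < e\<close>
      by (intro exI[of _ M]) simp
  qed
  \<comment> \<open>One index with \<open>X m - l\<close> square-summable suffices: \<open>l\<close>
    is then a difference of two square-summable sequences.\<close>
  obtain m where m: "summable (\<lambda>n. (norm (ell2_nth (X m) n - l n))\<^sup>2)"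
    using close[of 1] by auto
  have "summable (\<lambda>n. (norm (ell2_nth (X m) n + (-1) *\<^sub>C (ell2_nth (X m) n - l n)))\<^sup>2)"
    by (intro summable_norm_square_add summable_norm_square_scaleC m summable_ell2)
  then have l2: "summable (\<lambda>n. (norm (l n))\<^sup>2)"
    by (simp add: scaleC_minus_left)
  have diff: "X k - Abs_ell2 l = Abs_ell2 (\<lambda>n. ell2_nth (X k) n - l n)"
    if "summable (\<lambda>n. (norm (ell2_nth (X k) n - l n))\<^sup>2)" for k
    by (rule ell2_eqI) (simp add: ell2_nth_Abs[OF l2] ell2_nth_Abs[OF that])
  have "X \<longlonglongrightarrow> Abs_ell2 l"
  proof (rule metric_LIMSEQ_I)
    fix e :: real assume "0 < e"
    then obtain M where M: "\<forall>m\<ge>M. summable (\<lambda>n. (norm (ell2_nth (X m) n - l n))\<^sup>2) \<and>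
        norm (Abs_ell2 (\<lambda>n. ell2_nth (X m) n - l n)) \<le> e / 2"
      using close[of "e / 2"] by auto
    show "\<exists>M. \<forall>k\<ge>M. dist (X k) (Abs_ell2 l) < e"
    proof (intro exI allI impI)
      fix k assume "M \<le> k"
      then have "dist (X k) (Abs_ell2 l) \<le> e / 2"
        using M diff by (simp add: dist_norm)
      then show "dist (X k) (Abs_ell2 l) < e"
        using \<open>0 < e\<close> by linarith
    qed
  qed
  then show "convergent X"
    unfolding convergent_def by blast
qed

end

lemma ell2_sums_cinner: "(\<lambda>n. cinner (ell2_nth a n) (ell2_nth b n)) sums cinner a b"
  unfolding cinner_ell2_def by (rule summable_sums[OF summable_cinner_ell2])

lemma bounded_linear_ell2_nth: "bounded_linear (\<lambda>a. ell2_nth a n)"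
  by (rule bounded_linear_intro[where K = 1]) (simp_all add: norm_ell2_nth_le)

section \<open>The Hardy space as a sequence space\<close>

text \<open>The isometric embedding of the sequence space into \<open>H2\<close>, inverted by
  \<open>taylor_coeff\<close>; the value 0 off the disk is the convention of
  \<open>Hol\<close>.\<close>

definition ell2_fun :: "'a::complex_hilbert ell2 \<Rightarrow> complex \<Rightarrow> 'a" where
  "ell2_fun a z = (if z \<in> \<D> then \<Sum>n. z ^ n *\<^sub>C ell2_nth a n else 0)"

lemma ell2_fun_sums: "z \<in> \<D> \<Longrightarrow> (\<lambda>n. z ^ n *\<^sub>C ell2_nth a n) sums ell2_fun a z"
  using summable_sums[OF summable_powser[OF norm_ell2_nth_le]] by (simp add: ell2_fun_def)

lemma ell2_fun_outside: "z \<notin> \<D> \<Longrightarrow> ell2_fun a z = 0"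
  by (simp add: ell2_fun_def)

lemma ell2_fun_eqI:
  assumes "\<And>z. z \<in> \<D> \<Longrightarrow> (\<lambda>n. z ^ n *\<^sub>C ell2_nth a n) sums f z" "\<And>z. z \<notin> \<D> \<Longrightarrow> f z = 0"
  shows "ell2_fun a = f"
proof
  show "ell2_fun a z = f z" for z
  proof (cases "z \<in> \<D>")
    case True
    show ?thesis by (rule sums_unique2[OF ell2_fun_sums[OF True] assms(1)[OF True]])
  next
    case False
    show ?thesis unfolding ell2_fun_outside[OF False] assms(2)[OF False] ..
  qed
qed

lemma taylor_coeff_ell2_fun: "taylor_coeff (ell2_fun a) = ell2_nth a"
  by (rule taylor_coeff_eqI[OF ell2_fun_sums])

lemma inj_ell2_fun: "inj ell2_fun"
  by (rule injI) (metis taylor_coeff_ell2_fun ell2_nth_inject)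

lemma ell2_fun_in_Hol: "ell2_fun a \<in> Hol"
  using vholomorphic_on_powser[OF norm_ell2_nth_le ell2_fun_sums, of a]
  by (simp add: Hol_def ell2_fun_outside)

lemma ell2_fun_in_H2: "ell2_fun a \<in> H2"
  by (simp add: H2_def ell2_fun_in_Hol taylor_coeff_ell2_fun summable_ell2)

lemma H2_inner_ell2_fun: "H2_inner (ell2_fun a) (ell2_fun b) = cinner a b"
  by (simp add: H2_inner_def taylor_coeff_ell2_fun cinner_ell2_def)

lemma ell2_fun_add: "ell2_fun (a + b) = (\<lambda>z. ell2_fun a z + ell2_fun b z)"
  by (rule ell2_fun_eqI)
    (simp_all add: scaleC_add_right ell2_fun_outside sums_add[OF ell2_fun_sums ell2_fun_sums]
      del: mem_ball)

lemma ell2_fun_scaleC: "ell2_fun (c *\<^sub>C a) = (\<lambda>z. c *\<^sub>C ell2_fun a z)"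
proof (rule ell2_fun_eqI)
  fix z :: complex assume "z \<in> \<D>"
  then have "(\<lambda>n. c *\<^sub>C z ^ n *\<^sub>C ell2_nth a n) sums (c *\<^sub>C ell2_fun a z)"
    by (intro bounded_linear.sums[OF bounded_clinear_scaleC] ell2_fun_sums)
  then show "(\<lambda>n. z ^ n *\<^sub>C ell2_nth (c *\<^sub>C a) n) sums (c *\<^sub>C ell2_fun a z)"
    by (simp add: scaleC_scaleC mult.commute)
qed (simp add: ell2_fun_outside del: mem_ball)

lemma ell2_fun_diff: "ell2_fun (a - b) = (\<lambda>z. ell2_fun a z - ell2_fun b z)"
  by (rule ell2_fun_eqI)
    (simp_all add: scaleC_diff_right ell2_fun_outside sums_diff[OF ell2_fun_sums ell2_fun_sums]
      del: mem_ball)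

text \<open>The coefficients of \<open>y / (1 - z * cnj \<zeta>)\<close>, the reproducing kernel of
  the Hardy space.\<close>

definition szego :: "complex \<Rightarrow> 'a::complex_hilbert \<Rightarrow> 'a ell2" where
  "szego \<zeta> y = Abs_ell2 (\<lambda>n. cnj \<zeta> ^ n *\<^sub>C y)"

lemma ell2_nth_szego:
  assumes "\<zeta> \<in> \<D>"
  shows "ell2_nth (szego \<zeta> y) n = cnj \<zeta> ^ n *\<^sub>C y"
proof -
  have "(cmod \<zeta>)\<^sup>2 < 1"
    using assms by (simp add: power_less_one_iff abs_square_less_1)
  then have "summable (\<lambda>n. ((cmod \<zeta>)\<^sup>2) ^ n * (norm y)\<^sup>2)"
    by (intro summable_mult2 summable_geometric) simp
  then have "summable (\<lambda>n. (norm (cnj \<zeta> ^ n *\<^sub>C y))\<^sup>2)"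
    by (simp add: norm_scaleC norm_power power_mult_distrib power_mult[symmetric] mult.commute)
  then show ?thesis
    by (simp add: szego_def ell2_nth_Abs)
qed

lemma cinner_szego_right:
  assumes "\<zeta> \<in> \<D>"
  shows "cinner a (szego \<zeta> y) = cinner (ell2_fun a \<zeta>) y"
proof (rule sums_unique2[OF ell2_sums_cinner])
  have "(\<lambda>n. cinner (\<zeta> ^ n *\<^sub>C ell2_nth a n) y) sums cinner (ell2_fun a \<zeta>) y"
    by (rule bounded_linear.sums[OF bounded_linear_cinner_left ell2_fun_sums[OF assms]])
  then show "(\<lambda>n. cinner (ell2_nth a n) (ell2_nth (szego \<zeta> y) n)) sums cinner (ell2_fun a \<zeta>) y"
    by (simp add: ell2_nth_szego[OF assms] cinner_scaleC_left cinner_scaleC_right)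
qed

lemma cinner_szego_left:
  assumes "\<zeta> \<in> \<D>"
  shows "cinner (szego \<zeta> y) a = cinner y (ell2_fun a \<zeta>)"
  by (metis cinner_commute cinner_szego_right[OF assms])

lemma scaleC_sums_geometric:
  fixes y :: "'a::complex_hilbert"
  assumes "cmod w < 1"
  shows "(\<lambda>n. w ^ n *\<^sub>C y) sums ((1 / (1 - w)) *\<^sub>C y)"
  by (rule bounded_linear.sums[OF bounded_bilinear.bounded_linear_left[OF bounded_bilinear_scaleC]
        geometric_sums[OF assms]])

lemma ell2_fun_szego:
  assumes "\<zeta> \<in> \<D>" "z \<in> \<D>"
  shows "ell2_fun (szego \<zeta> y) z = (1 / (1 - z * cnj \<zeta>)) *\<^sub>C y"
proof -
  have "cmod (z * cnj \<zeta>) < 1"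
    using assms mult_strict_mono'[of "cmod z" 1 "cmod \<zeta>" 1] by (simp add: norm_mult)
  then have "(\<lambda>n. (z * cnj \<zeta>) ^ n *\<^sub>C y) sums ((1 / (1 - z * cnj \<zeta>)) *\<^sub>C y)"
    by (rule scaleC_sums_geometric)
  then have "(\<lambda>n. z ^ n *\<^sub>C ell2_nth (szego \<zeta> y) n) sums ((1 / (1 - z * cnj \<zeta>)) *\<^sub>C y)"
    by (simp add: ell2_nth_szego[OF assms(1)] scaleC_scaleC power_mult_distrib)
  then show ?thesis
    by (rule sums_unique2[OF ell2_fun_sums[OF assms(2)]])
qed

definition ell2_single :: "nat \<Rightarrow> 'a::complex_hilbert \<Rightarrow> 'a ell2" where
  "ell2_single n y = Abs_ell2 (\<lambda>k. if k = n then y else 0)"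

lemma ell2_nth_single: "ell2_nth (ell2_single n y) k = (if k = n then y else 0)"
proof -
  have "(\<lambda>k. (norm (if k = n then y else 0))\<^sup>2) sums (\<Sum>k\<in>{n}. (norm (if k = n then y else 0))\<^sup>2)"
    by (rule sums_finite) simp_all
  then show ?thesis
    unfolding ell2_single_def by (subst ell2_nth_Abs) (auto dest: sums_summable)
qed

lemma cinner_single_right: "cinner a (ell2_single n y) = cinner (ell2_nth a n) y"
proof (rule sums_unique2[OF ell2_sums_cinner])
  have "(\<lambda>k. cinner (ell2_nth a k) (ell2_nth (ell2_single n y) k)) sums
      (\<Sum>k\<in>{n}. cinner (ell2_nth a k) (ell2_nth (ell2_single n y) k))"
    by (rule sums_finite) (simp_all add: ell2_nth_single)
  then show "(\<lambda>k. cinner (ell2_nth a k) (ell2_nth (ell2_single n y) k)) sums cinner (ell2_nth a n) y"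
    by (simp add: ell2_nth_single)
qed

text \<open>Norm convergence of the expansion into monomials, so that a bounded operator can be
  applied termwise.\<close>

lemma sum_single_tendsto: "(\<lambda>N. \<Sum>n<N. ell2_single n (ell2_nth a n)) \<longlonglongrightarrow> a"
proof (rule Lim_null_comparison[THEN LIM_zero_cancel])
  define s where "s N = (\<Sum>n<N. ell2_single n (ell2_nth a n))" for N
  have nth: "ell2_nth (s N) k = (if k < N then ell2_nth a k else 0)" for N k
    unfolding s_def by (induction N) (auto simp: ell2_nth_single less_Suc_eq)
  \<comment> \<open>The first \<open>N\<close> coordinates of \<open>s N - a\<close> vanish, so its
    norm is that of the tail, written as the total minus the initial part.\<close>
  have "norm (s N - a) = sqrt ((norm a)\<^sup>2 - (\<Sum>k<N. (norm (ell2_nth a k))\<^sup>2))" for N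
  proof -
    have "(\<Sum>k. (norm (ell2_nth (s N - a) k))\<^sup>2)
        = (\<Sum>k. (norm (ell2_nth (s N - a) (k + N)))\<^sup>2) + (\<Sum>k<N. (norm (ell2_nth (s N - a) k))\<^sup>2)"
      by (rule suminf_split_initial_segment[OF summable_ell2])
    also have "\<dots> = (\<Sum>k. (norm (ell2_nth a (k + N)))\<^sup>2)"
      by (simp add: nth)
    also have "\<dots> = (norm a)\<^sup>2 - (\<Sum>k<N. (norm (ell2_nth a k))\<^sup>2)"
      unfolding norm_ell2_square by (rule suminf_minus_initial_segment[OF summable_ell2])
    finally show ?thesis
      by (simp add: norm_ell2_def[of "s N - a"])
  qed
  then show "\<forall>\<^sub>F N in sequentially. norm (s N - a) \<le> sqrt ((norm a)\<^sup>2 - (\<Sum>k<N. (norm (ell2_nth a k))\<^sup>2))"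
    by simp
  have "(\<lambda>N. sqrt ((norm a)\<^sup>2 - (\<Sum>k<N. (norm (ell2_nth a k))\<^sup>2))) \<longlonglongrightarrow> sqrt ((norm a)\<^sup>2 - (norm a)\<^sup>2)"
    unfolding norm_ell2_square
    by (intro tendsto_intros summable_LIMSEQ summable_ell2)
  then show "(\<lambda>N. sqrt ((norm a)\<^sup>2 - (\<Sum>k<N. (norm (ell2_nth a k))\<^sup>2))) \<longlonglongrightarrow> 0"
    by simp
qed

lemma ell2_fun_single:
  assumes "z \<in> \<D>"
  shows "ell2_fun (ell2_single n u) z = z ^ n *\<^sub>C u"
proof (rule sums_unique2[OF ell2_fun_sums[OF assms]])
  have "(\<lambda>k. z ^ k *\<^sub>C ell2_nth (ell2_single n u) k) sums
      (\<Sum>k\<in>{n}. z ^ k *\<^sub>C ell2_nth (ell2_single n u) k)"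
    by (rule sums_finite) (simp_all add: ell2_nth_single)
  then show "(\<lambda>k. z ^ k *\<^sub>C ell2_nth (ell2_single n u) k) sums (z ^ n *\<^sub>C u)"
    by (simp add: ell2_nth_single)
qed

lemma ell2_fun_single_0: "ell2_fun (ell2_single 0 u) = const_fun u"
proof
  fix z :: complex
  show "ell2_fun (ell2_single 0 u) z = const_fun u z"
    by (cases "z \<in> \<D>") (simp_all add: ell2_fun_single const_fun_def ell2_fun_outside del: mem_ball)
qed

section \<open>Hilbert spaces of functions\<close>

context hilbert_function_space
begin

lemma diff_mem: "f \<in> H \<Longrightarrow> g \<in> H \<Longrightarrow> (\<lambda>z. f z - g z) \<in> H"
  using add_mem[of f "\<lambda>z. (-1) *\<^sub>C g z"] scale_mem[of g "-1"] by (simp add: scaleC_minus_left)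

lemma ip_add_right:
  assumes "f \<in> H" "g \<in> H" "h \<in> H"
  shows "ip h (\<lambda>z. f z + g z) = ip h f + ip h g"
proof -
  have "ip h (\<lambda>z. f z + g z) = cnj (ip (\<lambda>z. f z + g z) h)"
    by (intro ip_commute add_mem assms)
  also have "\<dots> = cnj (ip f h) + cnj (ip g h)"
    by (simp add: ip_add assms)
  also have "\<dots> = ip h f + ip h g"
    by (simp only: ip_commute[OF assms(3,1)] ip_commute[OF assms(3,2)])
  finally show ?thesis .
qed

lemma ip_scale_right:
  assumes "f \<in> H" "h \<in> H"
  shows "ip h (\<lambda>z. c *\<^sub>C f z) = cnj c * ip h f"
proof -
  have "ip h (\<lambda>z. c *\<^sub>C f z) = cnj (ip (\<lambda>z. c *\<^sub>C f z) h)"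
    by (intro ip_commute scale_mem assms)
  also have "\<dots> = cnj c * cnj (ip f h)"
    by (simp add: ip_scale assms)
  finally show ?thesis
    by (simp only: ip_commute[OF assms(2,1)])
qed

lemma ip_diff: "f \<in> H \<Longrightarrow> g \<in> H \<Longrightarrow> h \<in> H \<Longrightarrow> ip (\<lambda>z. f z - g z) h = ip f h - ip g h"
  using ip_add[of f "\<lambda>z. (-1) *\<^sub>C g z" h] ip_scale[of g h "-1"] scale_mem[of g "-1"]
  by (simp add: scaleC_minus_left)

lemma ip_norm_nonneg: "f \<in> H \<Longrightarrow> 0 \<le> ip_norm ip f"
  by (simp add: ip_norm_def ip_nonneg)

lemma ip_norm_square: "f \<in> H \<Longrightarrow> (ip_norm ip f)\<^sup>2 = Re (ip f f)"
  by (simp add: ip_norm_def ip_nonneg)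

text \<open>\<open>H\<close> is a set of functions with an inner product of its own, not a type in
  \<open>complex_hilbert\<close>, so Cauchy--Schwarz is derived once more from the discriminant
  criterion.\<close>

lemma cmod_ip_le:
  assumes f: "f \<in> H" and g: "g \<in> H"
  shows "cmod (ip f g) \<le> ip_norm ip f * ip_norm ip g"
proof -
  have "(cmod (ip f g))\<^sup>2 \<le> (ip_norm ip g)\<^sup>2 * (ip_norm ip f)\<^sup>2"
  proof (rule cmod_square_le_of_quadratic_nonneg)
    fix t
    let ?k = "\<lambda>z. t *\<^sub>C f z"
    have k: "?k \<in> H" by (rule scale_mem[OF f])
    have "ip (\<lambda>z. g z + ?k z) (\<lambda>z. g z + ?k z)
        = ip g g + (ip ?k g + ip g ?k) + t * (cnj t * ip f f)"
      by (simp add: ip_add ip_add_right ip_scale ip_scale_right add_mem f g k)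
    moreover have "Re (ip g ?k) = Re (ip ?k g)"
      by (subst ip_commute[OF g k]) simp
    moreover have "t * (cnj t * ip f f) = of_real ((cmod t)\<^sup>2) * ip f f"
      by (simp only: complex_norm_square mult.assoc)
    ultimately have "Re (ip (\<lambda>z. g z + ?k z) (\<lambda>z. g z + ?k z))
        = (ip_norm ip g)\<^sup>2 + 2 * Re (t * ip f g) + (cmod t)\<^sup>2 * (ip_norm ip f)\<^sup>2"
      by (simp add: ip_norm_square f g ip_scale)
    then show "0 \<le> (ip_norm ip g)\<^sup>2 + 2 * Re (t * ip f g) + (cmod t)\<^sup>2 * (ip_norm ip f)\<^sup>2"
      using ip_nonneg[OF add_mem[OF g k]] by simp
  qed simp
  then have "(cmod (ip f g))\<^sup>2 \<le> (ip_norm ip f * ip_norm ip g)\<^sup>2"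
    by (simp only: power_mult_distrib mult.commute)
  then show ?thesis
    by (rule power2_le_imp_le) (simp add: ip_norm_nonneg f g)
qed

lemma tendsto_ip_left:
  assumes F: "\<And>n. F n \<in> H" and f: "f \<in> H" and g: "g \<in> H"
    and lim: "(\<lambda>n. ip_norm ip (\<lambda>z. F n z - f z)) \<longlonglongrightarrow> 0"
  shows "(\<lambda>n. ip (F n) g) \<longlonglongrightarrow> ip f g"
proof (rule LIM_zero_cancel, rule Lim_null_comparison)
  show "\<forall>\<^sub>F n in sequentially. norm (ip (F n) g - ip f g)
      \<le> ip_norm ip (\<lambda>z. F n z - f z) * ip_norm ip g"
    using cmod_ip_le[OF diff_mem[OF F f] g] by (simp add: ip_diff F f g)
  show "(\<lambda>n. ip_norm ip (\<lambda>z. F n z - f z) * ip_norm ip g) \<longlonglongrightarrow> 0"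
    by (rule tendsto_mult_left_zero[OF lim])
qed

end

section \<open>De Branges--Rovnyak spaces\<close>

text \<open>
  The triples \<open>(p, q, h)\<close> of corresponding linear combinations of Szego kernels \<open>s\<^sub>\<zeta> y\<close>, of
  \<open>s\<^sub>\<zeta> S(\<zeta>)\<^sup>*y = M\<^sub>S\<^sup>* s\<^sub>\<zeta> y\<close>, and of reproducing kernels \<open>K\<^sub>S(\<cdot>, \<zeta>) y = (I - M\<^sub>S M\<^sub>S\<^sup>*) s\<^sub>\<zeta> y\<close>.
\<close>

inductive kernel_comb ::
  "(complex \<Rightarrow> ('u::complex_hilbert \<Rightarrow>\<^sub>L 'y::complex_hilbert)) \<Rightarrow>
   'y ell2 \<Rightarrow> 'u ell2 \<Rightarrow> (complex \<Rightarrow> 'y) \<Rightarrow> bool" for S where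
  kernel: "\<zeta> \<in> \<D> \<Longrightarrow> kernel_comb S (szego \<zeta> y) (szego \<zeta> (cadjoint (blinfun_apply (S \<zeta>)) y))
    (\<lambda>z. if z \<in> \<D> then schur_kernel S z \<zeta> y else 0)"
| add: "kernel_comb S p q h \<Longrightarrow> kernel_comb S p' q' h' \<Longrightarrow>
    kernel_comb S (p + p') (q + q') (\<lambda>z. h z + h' z)"
| scale: "kernel_comb S p q h \<Longrightarrow> kernel_comb S (t *\<^sub>C p) (t *\<^sub>C q) (\<lambda>z. t *\<^sub>C h z)"

lemma kernel_comb_diff:
  assumes "kernel_comb S p q h" "kernel_comb S p' q' h'"
  shows "kernel_comb S (p - p') (q - q') (\<lambda>z. h z - h' z)"
  using kernel_comb.add[OF assms(1) kernel_comb.scale[OF assms(2), of "-1"]]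
  by (simp add: scaleC_minus_left)

locale de_branges_rovnyak = rkhs H ip "schur_kernel S"
  for H :: "(complex \<Rightarrow> 'y::complex_hilbert) set"
    and ip :: "(complex \<Rightarrow> 'y) \<Rightarrow> (complex \<Rightarrow> 'y) \<Rightarrow> complex"
    and S :: "complex \<Rightarrow> ('u::complex_hilbert \<Rightarrow>\<^sub>L 'y)" +
  assumes schur: "schur_class S"
begin

lemma clinear_S: "z \<in> \<D> \<Longrightarrow> bounded_clinear (blinfun_apply (S z))"
  using schur unfolding schur_class_def by blast

lemma kernel_comb_mem: "kernel_comb S p q h \<Longrightarrow> h \<in> H"
  by (induction rule: kernel_comb.induct) (intro kernel_mem add_mem scale_mem; assumption)+

lemma kernel_comb_eval:
  assumes "kernel_comb S p q h" and z: "z \<in> \<D>"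
  shows "h z = ell2_fun p z - blinfun_apply (S z) (ell2_fun q z)"
  using assms(1)
proof (induction rule: kernel_comb.induct)
  case (kernel \<zeta> y)
  then show ?case
    unfolding ell2_fun_szego[OF kernel z] bounded_clinear_scale[OF clinear_S[OF z]]
      scaleC_diff_right[symmetric]
    using z by (simp add: schur_kernel_def)
next
  case (add p q h p' q' h')
  then show ?case
    by (simp add: ell2_fun_add blinfun.add_right)
next
  case (scale p q h t)
  then show ?case
    by (simp add: ell2_fun_scaleC bounded_clinear_scale[OF clinear_S[OF z]] scaleC_diff_right)
qed

text \<open>One induction, over the second triple, is enough: in the kernel case the reproducing
  property evaluates an arbitrary \<open>h\<close> at \<open>\<zeta>\<close>, and
  \<open>kernel_comb_eval\<close> with the Szego kernels does the rest.\<close>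

lemma ip_kernel_comb:
  assumes h: "kernel_comb S p q h" and h': "kernel_comb S p' q' h'"
  shows "ip h h' = cinner p p' - cinner q q'"
  using h'
proof (induction rule: kernel_comb.induct)
  case (kernel \<zeta> y)
  show ?case
    unfolding reproducing[OF kernel kernel_comb_mem[OF h]] kernel_comb_eval[OF h kernel]
      cinner_szego_right[OF kernel] cinner_diff_left cinner_cadjoint_right[OF clinear_S[OF kernel]] ..
next
  case (add p1 q1 h1 p2 q2 h2)
  then show ?case
    by (simp add: ip_add_right kernel_comb_mem[OF h] kernel_comb_mem cinner_add_right)
next
  case (scale p1 q1 h1 t)
  then show ?case
    by (simp add: ip_scale_right kernel_comb_mem[OF h] kernel_comb_mem cinner_scaleC_right
        right_diff_distrib)
qed

text \<open>Here positivity of the kernel enters: the squared norm of \<open>h\<close> is the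
  difference of those of \<open>p\<close> and \<open>q\<close>, and it is nonnegative.\<close>

lemma kernel_comb_norm:
  assumes "kernel_comb S p q h"
  shows "norm q \<le> norm p" "ip_norm ip h \<le> norm p"
proof -
  have *: "(ip_norm ip h)\<^sup>2 = (norm p)\<^sup>2 - (norm q)\<^sup>2"
    using ip_kernel_comb[OF assms assms] kernel_comb_mem[OF assms]
    by (simp add: ip_norm_square Re_cinner_self)
  have "(norm q)\<^sup>2 \<le> (norm p)\<^sup>2"
    using zero_le_power2[of "ip_norm ip h"] unfolding * by simp
  then show "norm q \<le> norm p"
    by (rule power2_le_imp_le) simp
  show "ip_norm ip h \<le> norm p"
    by (rule power2_le_imp_le) (simp_all add: *)
qed

text \<open>
  Vectors of \<open>\<ell>\<^sup>2\<close>, hence power series, are obtained from bounds on the span of the Szego kernels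
  alone.
\<close>

lemma kernel_comb_represent:
  assumes add: "\<And>p q h p' q' h'. kernel_comb S p q h \<Longrightarrow> kernel_comb S p' q' h' \<Longrightarrow>
      \<phi> (p + p') (q + q') (\<lambda>z. h z + h' z) = \<phi> p q h + \<phi> p' q' h'"
    and scale: "\<And>p q h t. kernel_comb S p q h \<Longrightarrow> \<phi> (t *\<^sub>C p) (t *\<^sub>C q) (\<lambda>z. t *\<^sub>C h z) = t * \<phi> p q h"
    and bound: "\<And>p q h. kernel_comb S p q h \<Longrightarrow> cmod (\<phi> p q h) \<le> B * norm p" and "0 \<le> B"
  shows "\<exists>g\<in>closure {p. \<exists>q h. kernel_comb S p q h}. norm g \<le> B \<and>
    (\<forall>p q h. kernel_comb S p q h \<longrightarrow> \<phi> p q h = cinner p g)"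
proof -
  \<comment> \<open>The value \<open>\<phi> p q h\<close> may a priori depend on more than
    \<open>p\<close>, so \<open>\<Gamma>\<close> is only a relation; the bound, applied to
    differences, makes it single-valued.\<close>
  define \<Gamma> where "\<Gamma> = {(p, \<phi> p q h) |p q h. kernel_comb S p q h}"
  have \<Gamma>I: "(p, \<phi> p q h) \<in> \<Gamma>" if "kernel_comb S p q h" for p q h
    using that unfolding \<Gamma>_def by blast
  have \<Gamma>E: "\<exists>q h. kernel_comb S v q h \<and> c = \<phi> v q h" if "(v, c) \<in> \<Gamma>" for v c
    using that unfolding \<Gamma>_def by blast
  have "0 \<in> \<D>" by simp
  then have "\<Gamma> \<noteq> {}"
    using \<Gamma>I[OF kernel_comb.kernel] by blast
  moreover have "(v + w, c + d) \<in> \<Gamma>" if vc: "(v, c) \<in> \<Gamma>" and wd: "(w, d) \<in> \<Gamma>" for v c w d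
  proof -
    obtain q h q' h' where *: "kernel_comb S v q h" "c = \<phi> v q h" "kernel_comb S w q' h'" "d = \<phi> w q' h'"
      using \<Gamma>E[OF vc] \<Gamma>E[OF wd] by blast
    show ?thesis
      using \<Gamma>I[OF kernel_comb.add[OF *(1,3)]] unfolding add[OF *(1,3)] *(2,4) .
  qed
  moreover have "(t *\<^sub>C v, t * c) \<in> \<Gamma>" if vc: "(v, c) \<in> \<Gamma>" for v c t
  proof -
    obtain q h where *: "kernel_comb S v q h" "c = \<phi> v q h"
      using \<Gamma>E[OF vc] by blast
    show ?thesis
      using \<Gamma>I[OF kernel_comb.scale[OF *(1)]] unfolding scale[OF *(1)] *(2) .
  qed
  moreover have "cmod c \<le> B * norm v" if "(v, c) \<in> \<Gamma>" for v c
    using \<Gamma>E[OF that] bound by blast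
  ultimately obtain g where g: "g \<in> closure (fst ` \<Gamma>)" "norm g \<le> B"
    "\<And>v c. (v, c) \<in> \<Gamma> \<Longrightarrow> c = cinner v g"
    using riesz_representation_graph[of \<Gamma> B] \<open>0 \<le> B\<close> by metis
  have "fst ` \<Gamma> \<subseteq> {p. \<exists>q h. kernel_comb S p q h}"
    unfolding \<Gamma>_def by clarsimp blast
  then have "g \<in> closure {p. \<exists>q h. kernel_comb S p q h}"
    using g(1) closure_mono by blast
  with g(2) g(3)[OF \<Gamma>I] show ?thesis by blast
qed

text \<open>Since \<open>q\<close>, which is to become the image of \<open>p\<close> under the
  adjoint of multiplication, is no longer than \<open>p\<close>, the functional
  \<open>p \<mapsto> cinner q f\<close> is bounded. Pairing with Szego kernels shows that the vector
  \<open>g\<close> representing it has the values of \<open>S f\<close>.\<close>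

lemma mult_op_in_range:
  "\<exists>g. norm g \<le> norm f \<and> ell2_fun g = mult_op S (ell2_fun f)"
proof -
  have bound: "cmod (cinner q f) \<le> norm f * norm p" if "kernel_comb S p q h" for p q h
  proof -
    have "cmod (cinner q f) \<le> norm q * norm f" by (rule cmod_cinner_le)
    also have "\<dots> \<le> norm p * norm f"
      by (intro mult_right_mono kernel_comb_norm(1)[OF that]) simp
    finally show ?thesis by (simp add: mult.commute)
  qed
  have "\<exists>g\<in>closure {p. \<exists>q h. kernel_comb S p q h}. norm g \<le> norm f \<and>
      (\<forall>p q h. kernel_comb S p q h \<longrightarrow> cinner q f = cinner p g)"
    by (rule kernel_comb_represent) (simp_all add: cinner_add_left cinner_scaleC_left bound)
  then obtain g where g: "norm g \<le> norm f"
    "\<And>p q h. kernel_comb S p q h \<Longrightarrow> cinner q f = cinner p g"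
    by blast
  have "ell2_fun g = mult_op S (ell2_fun f)"
  proof
    fix z
    show "ell2_fun g z = mult_op S (ell2_fun f) z"
    proof (cases "z \<in> \<D>")
      case True
      show ?thesis
      proof (rule cinner_ext_left)
        fix y
        have "cinner y (ell2_fun g z) = cinner (cadjoint (blinfun_apply (S z)) y) (ell2_fun f z)"
          using g(2)[OF kernel_comb.kernel[OF True]] by (simp only: cinner_szego_left[OF True])
        then show "cinner y (ell2_fun g z) = cinner y (mult_op S (ell2_fun f) z)"
          by (simp only: cinner_cadjoint_left[OF clinear_S[OF True]] mult_op_def)
      qed
    next
      case False
      show ?thesis
        unfolding mult_op_def ell2_fun_outside[OF False] by simp
    qed
  qed
  with g(1) show ?thesis by blast
qed

text \<open>Multiplication is transported to sequences through the injective
  \<open>ell2_fun\<close>; by \<open>mult_op_in_range\<close> the inverse is taken on the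
  range.\<close>

definition mult_S :: "'u ell2 \<Rightarrow> 'y ell2" where
  "mult_S f = inv ell2_fun (mult_op S (ell2_fun f))"

lemma ell2_fun_mult_S: "ell2_fun (mult_S f) = mult_op S (ell2_fun f)"
  unfolding mult_S_def using mult_op_in_range[of f] by (intro f_inv_into_f) (metis rangeI)

lemma norm_mult_S_le: "norm (mult_S f) \<le> norm f"
  using mult_op_in_range[of f] ell2_fun_mult_S[of f] injD[OF inj_ell2_fun] by metis

lemma bounded_clinear_mult_S: "bounded_clinear mult_S"
proof (rule bounded_clinearI)
  fix f g and c
  show "mult_S (f + g) = mult_S f + mult_S g"
    by (rule injD[OF inj_ell2_fun])
      (simp add: ell2_fun_mult_S ell2_fun_add mult_op_def blinfun.add_right)
  show "mult_S (c *\<^sub>C f) = c *\<^sub>C mult_S f"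
  proof (rule injD[OF inj_ell2_fun], rule ext)
    fix z
    show "ell2_fun (mult_S (c *\<^sub>C f)) z = ell2_fun (c *\<^sub>C mult_S f) z"
    proof (cases "z \<in> \<D>")
      case True
      then show ?thesis
        by (simp add: ell2_fun_mult_S ell2_fun_scaleC mult_op_def
            bounded_clinear_scale[OF clinear_S[OF True]])
    qed (simp add: ell2_fun_outside del: mem_ball)
  qed
  show "norm (mult_S f) \<le> norm f * 1"
    by (simp add: norm_mult_S_le)
qed

abbreviation "mult_S_adj \<equiv> cadjoint mult_S"

text \<open>Representing \<open>p \<mapsto> cinner p f\<close> on the span yields some
  \<open>g\<close> in its closure. Against Szego kernels \<open>g\<close> agrees with
  \<open>f\<close>, so both have the same values and \<open>g = f\<close>.\<close>

lemma kernel_comb_dense: "f \<in> closure {p. \<exists>q h. kernel_comb S p q h}"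
proof -
  have bound: "cmod (cinner p f) \<le> norm f * norm p" for p
    using cmod_cinner_le[of p f] by (simp add: mult.commute)
  have "\<exists>g\<in>closure {p. \<exists>q h. kernel_comb S p q h}. norm g \<le> norm f \<and>
      (\<forall>p q h. kernel_comb S p q h \<longrightarrow> cinner p f = cinner p g)"
    by (rule kernel_comb_represent) (simp_all add: cinner_add_left cinner_scaleC_left bound)
  then obtain g where g: "g \<in> closure {p. \<exists>q h. kernel_comb S p q h}"
    "\<And>p q h. kernel_comb S p q h \<Longrightarrow> cinner p f = cinner p g"
    by blast
  have "ell2_fun g z = ell2_fun f z" for z
  proof (cases "z \<in> \<D>")
    case True
    show ?thesis
      using g(2)[OF kernel_comb.kernel[OF True]]
      by (intro cinner_ext_left) (simp only: cinner_szego_left[OF True])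
  qed (simp add: ell2_fun_outside del: mem_ball)
  then have "g = f"
    by (intro injD[OF inj_ell2_fun] ext)
  with g(1) show ?thesis by simp
qed

text \<open>The functional \<open>h \<mapsto> ip h f\<close> is bounded in terms of \<open>p\<close>
  by Cauchy--Schwarz and \<open>kernel_comb_norm\<close>. On kernel triples the representing vector
  reproduces the values of \<open>f\<close>, which places \<open>H\<close> inside the Hardy
  space.\<close>

lemma mem_H_represent:
  assumes f: "f \<in> H"
  obtains g where "f = ell2_fun g" "\<And>p q h. kernel_comb S p q h \<Longrightarrow> ip h f = cinner p g"
proof -
  have bound: "cmod (ip h f) \<le> ip_norm ip f * norm p" if "kernel_comb S p q h" for p q h
  proof -
    have "cmod (ip h f) \<le> ip_norm ip h * ip_norm ip f"
      by (rule cmod_ip_le[OF kernel_comb_mem[OF that] f])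
    also have "\<dots> \<le> norm p * ip_norm ip f"
      by (intro mult_right_mono kernel_comb_norm(2)[OF that] ip_norm_nonneg f)
    finally show ?thesis by (simp add: mult.commute)
  qed
  have "\<exists>g\<in>closure {p. \<exists>q h. kernel_comb S p q h}. norm g \<le> ip_norm ip f \<and>
      (\<forall>p q h. kernel_comb S p q h \<longrightarrow> ip h f = cinner p g)"
    by (rule kernel_comb_represent)
      (simp_all add: ip_add ip_scale kernel_comb_mem f ip_norm_nonneg bound)
  then obtain g where g: "\<And>p q h. kernel_comb S p q h \<Longrightarrow> ip h f = cinner p g"
    by blast
  have "f z = ell2_fun g z" for z
  proof (cases "z \<in> \<D>")
    case True
    show ?thesis
    proof (rule cinner_ext_left)
      fix y
      let ?k = "\<lambda>w. if w \<in> \<D> then schur_kernel S w z y else 0"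
      have "ip ?k f = cnj (cinner (f z) y)"
        unfolding reproducing[OF True f, symmetric] by (rule ip_commute[OF kernel_mem[OF True] f])
      then show "cinner y (f z) = cinner y (ell2_fun g z)"
        using g[OF kernel_comb.kernel[OF True]]
        by (simp only: cinner_szego_left[OF True] cinner_commute[of y "f z"])
    qed
  next
    case False
    show ?thesis unfolding vanish[OF f False] ell2_fun_outside[OF False] ..
  qed
  then show thesis
    using that g by blast
qed

text \<open>The adjoint of multiplication sends the Szego kernel at \<open>\<zeta>\<close> with
  vector \<open>y\<close> to the one with vector \<open>cadjoint (S \<zeta>) y\<close>; linearity
  extends this to the span.\<close>

lemma kernel_comb_adj: "kernel_comb S p q h \<Longrightarrow> q = mult_S_adj p"
proof (induction rule: kernel_comb.induct)
  case (kernel \<zeta> y)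
  show ?case
  proof (rule cinner_ext_left)
    fix v
    show "cinner v (szego \<zeta> (cadjoint (blinfun_apply (S \<zeta>)) y)) = cinner v (mult_S_adj (szego \<zeta> y))"
      by (simp only: cinner_cadjoint_right[OF bounded_clinear_mult_S] cinner_szego_right[OF kernel]
          cinner_cadjoint_right[OF clinear_S[OF kernel]] ell2_fun_mult_S mult_op_def)
  qed
qed (simp_all add: bounded_clinear_add bounded_clinear_scale
    bounded_clinear_cadjoint[OF bounded_clinear_mult_S])

text \<open>The operator \<open>I - M\<^sub>S M\<^sub>S\<^sup>*\<close> is the adjoint of the inclusion of \<open>\<H>(K\<^sub>S)\<close> into \<open>H\<^sup>2\<close>.\<close>

definition defect :: "'y ell2 \<Rightarrow> 'y ell2" where
  "defect f = f - mult_S (mult_S_adj f)"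

lemma kernel_comb_eq_defect:
  assumes "kernel_comb S p q h"
  shows "h = ell2_fun (defect p)"
proof
  fix z
  show "h z = ell2_fun (defect p) z"
  proof (cases "z \<in> \<D>")
    case True
    show ?thesis
      unfolding kernel_comb_eval[OF assms True] kernel_comb_adj[OF assms]
      by (simp add: defect_def ell2_fun_diff ell2_fun_mult_S mult_op_def)
  next
    case False
    show ?thesis
      unfolding vanish[OF kernel_comb_mem[OF assms] False] ell2_fun_outside[OF False] ..
  qed
qed

lemma tendsto_defect:
  assumes "X \<longlonglongrightarrow> f"
  shows "(\<lambda>n. defect (X n)) \<longlonglongrightarrow> defect f"
proof -
  have "(\<lambda>n. mult_S (mult_S_adj (X n))) \<longlonglongrightarrow> mult_S (mult_S_adj f)"
    by (rule bounded_linear.tendsto[OF bounded_clinear_bounded_linear assms])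
      (rule bounded_clinear_compose[OF bounded_clinear_mult_S
          bounded_clinear_cadjoint[OF bounded_clinear_mult_S]])
  with assms show ?thesis
    unfolding defect_def by (rule tendsto_diff)
qed

text \<open>Approximate \<open>f\<close> by first components \<open>X n\<close> of triples. Their
  images under \<open>defect\<close> are Cauchy in \<open>H\<close> because
  \<open>ip_norm ip h \<le> norm p\<close>; the limit in \<open>H\<close> has the values of
  \<open>defect f\<close>, since evaluation is continuous in both metrics.\<close>

lemma defect_in_H: "ell2_fun (defect f) \<in> H"
  and ip_defect: "ell2_fun g \<in> H \<Longrightarrow> ip (ell2_fun (defect f)) (ell2_fun g) = cinner f g"
proof -
  obtain X where X: "\<And>n. \<exists>q h. kernel_comb S (X n) q h" "X \<longlonglongrightarrow> f"
    using kernel_comb_dense[of f] unfolding closure_sequential by blast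
  define F where "F n = ell2_fun (defect (X n))" for n
  have comb: "\<exists>q. kernel_comb S (X n) q (F n)" for n
    using X(1)[of n] kernel_comb_eq_defect unfolding F_def by blast
  have mem: "F n \<in> H" for n
    using comb[of n] kernel_comb_mem by blast
  have Cauchy: "\<exists>M. \<forall>m\<ge>M. \<forall>n\<ge>M. ip_norm ip (\<lambda>z. F m z - F n z) < e" if "0 < e" for e
  proof -
    have "ip_norm ip (\<lambda>z. F m z - F n z) \<le> dist (X m) (X n)" for m n
      using comb[of m] comb[of n] kernel_comb_diff kernel_comb_norm(2) unfolding dist_norm by blast
    then show ?thesis
      using metric_CauchyD[OF LIMSEQ_imp_Cauchy[OF X(2)] that] by (meson le_less_trans)
  qed
  obtain h where h: "h \<in> H" "(\<lambda>n. ip_norm ip (\<lambda>z. F n z - h z)) \<longlonglongrightarrow> 0"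
    using complete[OF mem Cauchy] by blast
  have "h z = ell2_fun (defect f) z" for z
  proof (cases "z \<in> \<D>")
    case True
    show ?thesis
    proof (rule cinner_ext_right)
      fix y
      have "(\<lambda>n. cinner (F n z) y) \<longlonglongrightarrow> cinner (h z) y"
        using tendsto_ip_left[OF mem h(1) kernel_mem[OF True] h(2)]
        by (simp only: reproducing[OF True] mem h(1))
      moreover have "(\<lambda>n. cinner (F n z) y) \<longlonglongrightarrow> cinner (ell2_fun (defect f) z) y"
        unfolding F_def cinner_szego_right[OF True, symmetric]
        by (intro tendsto_cinner tendsto_defect X(2) tendsto_const)
      ultimately show "cinner (h z) y = cinner (ell2_fun (defect f) z) y"
        by (rule LIMSEQ_unique)
    qed
  next
    case False
    show ?thesis unfolding vanish[OF h(1) False] ell2_fun_outside[OF False] ..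
  qed
  then have h_eq: "h = ell2_fun (defect f)" ..
  with h(1) show "ell2_fun (defect f) \<in> H" by simp
  assume g: "ell2_fun g \<in> H"
  \<comment> \<open>Injectivity of \<open>ell2_fun\<close> identifies \<open>g'\<close> with
    \<open>g\<close>; the identity known on the span then passes to the limit.\<close>
  obtain g' where g': "ell2_fun g = ell2_fun g'"
    "\<And>p q h. kernel_comb S p q h \<Longrightarrow> ip h (ell2_fun g) = cinner p g'"
    using mem_H_represent[OF g] by blast
  have "(\<lambda>n. ip (F n) (ell2_fun g)) \<longlonglongrightarrow> ip h (ell2_fun g)"
    by (rule tendsto_ip_left[OF mem h(1) g h(2)])
  moreover have "ip (F n) (ell2_fun g) = cinner (X n) g" for n
    using comb[of n] g' injD[OF inj_ell2_fun g'(1)] by blast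
  moreover have "(\<lambda>n. cinner (X n) g) \<longlonglongrightarrow> cinner f g"
    by (intro tendsto_cinner X(2) tendsto_const)
  ultimately show "ip (ell2_fun (defect f)) (ell2_fun g) = cinner f g"
    unfolding h_eq by (simp add: LIMSEQ_unique)
qed

lemma cinner_defect: "cinner f (defect g) = cinner f g - cinner (mult_S_adj f) (mult_S_adj g)"
  by (simp add: defect_def cinner_diff_right cinner_cadjoint_left[OF bounded_clinear_mult_S])

section \<open>Taylor coefficients of \<open>S\<close> and the matrix of multiplication\<close>

context
  fixes Sc :: "nat \<Rightarrow> ('u \<Rightarrow>\<^sub>L 'y)"
  assumes Sc: "\<And>z. z \<in> \<D> \<Longrightarrow> (\<lambda>j. z ^ j *\<^sub>C Sc j) sums S z"
begin

lemma Sc_sums: "z \<in> \<D> \<Longrightarrow> (\<lambda>j. z ^ j *\<^sub>C blinfun_apply (Sc j) u) sums blinfun_apply (S z) u"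
  using bounded_linear.sums[OF blinfun.bounded_linear_left Sc] by (simp add: scaleC_blinfun_apply)

text \<open>The type of \<open>Sc j\<close> gives real linearity only; complex linearity is
  inherited from the values \<open>S z\<close> by uniqueness of power series coefficients.\<close>

lemma bounded_clinear_Sc: "bounded_clinear (blinfun_apply (Sc j))"
  unfolding bounded_clinear_def
proof (intro conjI allI)
  fix c u
  have "(\<lambda>j. z ^ j *\<^sub>C c *\<^sub>C blinfun_apply (Sc j) u) sums blinfun_apply (S z) (c *\<^sub>C u)"
    if z: "z \<in> \<D>" for z
  proof -
    have "(\<lambda>j. c *\<^sub>C z ^ j *\<^sub>C blinfun_apply (Sc j) u) sums (c *\<^sub>C blinfun_apply (S z) u)"
      by (rule bounded_linear.sums[OF bounded_clinear_scaleC Sc_sums[OF z]])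
    then show ?thesis
      by (simp add: bounded_clinear_scale[OF clinear_S[OF z]] scaleC_scaleC mult.commute)
  qed
  then have "(\<lambda>j. c *\<^sub>C blinfun_apply (Sc j) u) = (\<lambda>j. blinfun_apply (Sc j) (c *\<^sub>C u))"
    by (rule powser_coeff_unique[OF _ Sc_sums])
  then show "blinfun_apply (Sc j) (c *\<^sub>C u) = c *\<^sub>C blinfun_apply (Sc j) u"
    by (simp add: fun_eq_iff)
qed (rule blinfun.bounded_linear_right)

text \<open>A column of the lower triangular block Toeplitz matrix of multiplication: the factor
  \<open>z^n\<close> shifts the series of \<open>S z\<close> by \<open>n\<close>.\<close>

lemma ell2_nth_mult_S_single:
  "ell2_nth (mult_S (ell2_single n u)) k = (if n \<le> k then blinfun_apply (Sc (k - n)) u else 0)"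
proof -
  define b where "b k = (if n \<le> k then blinfun_apply (Sc (k - n)) u else 0)" for k
  have "(\<lambda>k. z ^ k *\<^sub>C b k) sums ell2_fun (mult_S (ell2_single n u)) z" if z: "z \<in> \<D>" for z
  proof -
    have "ell2_fun (mult_S (ell2_single n u)) z = z ^ n *\<^sub>C blinfun_apply (S z) u"
      by (simp add: ell2_fun_single[OF z] ell2_fun_mult_S mult_op_def
          bounded_clinear_scale[OF clinear_S[OF z]])
    moreover have "(\<lambda>j. z ^ n *\<^sub>C z ^ j *\<^sub>C blinfun_apply (Sc j) u) sums (z ^ n *\<^sub>C blinfun_apply (S z) u)"
      by (rule bounded_linear.sums[OF bounded_clinear_scaleC Sc_sums[OF z]])
    ultimately have "(\<lambda>j. z ^ (j + n) *\<^sub>C b (j + n)) sums ell2_fun (mult_S (ell2_single n u)) z"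
      by (simp add: b_def scaleC_scaleC power_add mult.commute)
    \<comment> \<open>\<open>b\<close> vanishes below \<open>n\<close>, so the shifted series has
      the same sum as the full one.\<close>
    then show ?thesis
      by (subst (asm) sums_zero_iff_shift) (simp_all add: b_def)
  qed
  then have "b = ell2_nth (mult_S (ell2_single n u))"
    by (rule powser_coeff_unique[OF _ ell2_fun_sums])
  then show ?thesis
    by (simp add: b_def fun_eq_iff)
qed

lemma ell2_nth_mult_S_adj_single:
  "ell2_nth (mult_S_adj (ell2_single k y)) n =
    (if n \<le> k then cadjoint (blinfun_apply (Sc (k - n))) y else 0)"
proof (rule cinner_ext_left)
  fix u
  have "cinner u (ell2_nth (mult_S_adj (ell2_single k y)) n)
      = cnj (cinner (mult_S_adj (ell2_single k y)) (ell2_single n u))"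
    by (simp add: cinner_single_right cinner_commute[symmetric])
  also have "\<dots> = cinner (mult_S (ell2_single n u)) (ell2_single k y)"
    by (simp only: cinner_cadjoint_left[OF bounded_clinear_mult_S] cinner_commute[symmetric])
  also have "\<dots> = cinner u (if n \<le> k then cadjoint (blinfun_apply (Sc (k - n))) y else 0)"
    by (simp add: cinner_single_right ell2_nth_mult_S_single
        cinner_cadjoint_right[OF bounded_clinear_Sc])
  finally show "cinner u (ell2_nth (mult_S_adj (ell2_single k y)) n) =
      cinner u (if n \<le> k then cadjoint (blinfun_apply (Sc (k - n))) y else 0)" .
qed

text \<open>Row \<open>n\<close> of the adjoint, upper triangular matrix: entries before the
  diagonal vanish, hence the index \<open>j + n\<close>. Row 0 gives the series that defines
  \<open>N\<close>, the other rows give \<open>N\<close> after powers of \<open>T\<close>.\<close>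

lemma ell2_nth_mult_S_adj_sums:
  "(\<lambda>j. cadjoint (blinfun_apply (Sc j)) (ell2_nth f (j + n))) sums ell2_nth (mult_S_adj f) n"
proof -
  have bl: "bounded_linear mult_S_adj"
    by (rule bounded_clinear_bounded_linear[OF bounded_clinear_cadjoint[OF bounded_clinear_mult_S]])
  have "(\<lambda>k. ell2_single k (ell2_nth f k)) sums f"
    unfolding sums_def by (rule sum_single_tendsto)
  then have "(\<lambda>k. ell2_nth (mult_S_adj (ell2_single k (ell2_nth f k))) n) sums ell2_nth (mult_S_adj f) n"
    by (intro bounded_linear.sums[OF bounded_linear_ell2_nth] bounded_linear.sums[OF bl])
  then have "(\<lambda>j. ell2_nth (mult_S_adj (ell2_single (j + n) (ell2_nth f (j + n)))) n) sums
      ell2_nth (mult_S_adj f) n"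
    by (subst sums_zero_iff_shift) (simp_all add: ell2_nth_mult_S_adj_single)
  then show ?thesis
    by (simp add: ell2_nth_mult_S_adj_single)
qed

end

end

section \<open>Output-stable pairs\<close>

definition observability_ell2 ::
  "('x::complex_hilbert \<Rightarrow> 'y::complex_hilbert) \<Rightarrow> ('x \<Rightarrow> 'x) \<Rightarrow> 'x \<Rightarrow> 'y ell2" where
  "observability_ell2 E T x = Abs_ell2 (\<lambda>n. E ((T ^^ n) x))"

text \<open>Uniqueness of Taylor coefficients and output stability make the sequence
  square-summable, so \<open>Abs_ell2\<close> is applied within its domain.\<close>

lemma ell2_nth_observability:
  assumes "output_stable E T"
  shows "ell2_nth (observability_ell2 E T x) n = E ((T ^^ n) x)"
proof -
  have "(\<lambda>n. z ^ n *\<^sub>C E ((T ^^ n) x)) sums observability E T x z" if "z \<in> \<D>" for z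
    using assms that unfolding output_stable_def analytic_output_pair_def observability_def
    by (simp add: summable_sums)
  then have "taylor_coeff (observability E T x) = (\<lambda>n. E ((T ^^ n) x))"
    by (rule taylor_coeff_eqI)
  moreover have "observability E T x \<in> H2"
    using assms unfolding output_stable_def by blast
  ultimately show ?thesis
    by (simp add: H2_def observability_ell2_def ell2_nth_Abs)
qed

lemma ell2_fun_eq_observability:
  assumes "\<And>n. ell2_nth a n = E ((T ^^ n) x)"
  shows "ell2_fun a = observability E T x"
  unfolding ell2_fun_def observability_def by (simp add: fun_eq_iff assms)

text \<open>Square-summable coefficients already give a holomorphic sum; this is how the pair
  \<open>(N, T)\<close> is handled.\<close>

lemma analytic_output_pairI:
  assumes "\<And>x n. ell2_nth (A x) n = E ((T ^^ n) x)"
  shows "analytic_output_pair E T"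
  unfolding analytic_output_pair_def
proof (intro allI conjI ballI)
  show "observability E T x \<in> Hol" for x
    using ell2_fun_in_Hol[of "A x"] ell2_fun_eq_observability[of "A x" E T x] assms by simp
  show "summable (\<lambda>n. z ^ n *\<^sub>C E ((T ^^ n) x))" if "z \<in> \<D>" for x z
    using sums_summable[OF ell2_fun_sums[OF that, of "A x"]] by (simp add: assms)
qed

lemma bounded_clinear_funpow:
  fixes T :: "'x::complex_normed_vector \<Rightarrow> 'x"
  assumes "bounded_clinear T"
  shows "(T ^^ n) (x + y) = (T ^^ n) x + (T ^^ n) y" "(T ^^ n) (c *\<^sub>C x) = c *\<^sub>C (T ^^ n) x"
  by (induction n) (simp_all add: bounded_clinear_add[OF assms] bounded_clinear_scale[OF assms])

lemma bounded_clinear_observability: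
  assumes E: "bounded_clinear E" and T: "bounded_clinear T" and stable: "output_stable E T"
  shows "bounded_clinear (observability_ell2 E T)"
proof -
  obtain C where C: "\<And>x. ip_norm H2_inner (observability E T x) \<le> C * norm x"
    using stable unfolding output_stable_def by blast
  have norm: "ip_norm H2_inner (observability E T x) = norm (observability_ell2 E T x)" for x
    unfolding ip_norm_def
      ell2_fun_eq_observability[of "observability_ell2 E T x", symmetric, OF ell2_nth_observability[OF stable]]
      H2_inner_ell2_fun Re_cinner_self by simp
  show ?thesis
  proof (rule bounded_clinearI)
    show "norm (observability_ell2 E T x) \<le> norm x * C" for x
      using C[of x] by (simp add: norm mult.commute)
  qed (rule ell2_eqI, simp add: ell2_nth_observability[OF stable] bounded_clinear_funpow[OF T]
      bounded_clinear_add[OF E] bounded_clinear_scale[OF E])+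
qed

text \<open>\<open>a'\<close> and \<open>b'\<close> are backward shifts. Since the shift of the
  coefficients at \<open>x\<close> is the sequence at \<open>T x\<close>, this is the source of the
  Stein equation.\<close>

lemma cinner_ell2_split_head:
  assumes "\<And>n. ell2_nth a' n = ell2_nth a (Suc n)" "\<And>n. ell2_nth b' n = ell2_nth b (Suc n)"
  shows "cinner a b = cinner (ell2_nth a 0) (ell2_nth b 0) + cinner a' b'"
  using suminf_split_head[OF summable_cinner_ell2[of a b]] by (simp add: cinner_ell2_def assms)

theorem lemma6p1:
  fixes E :: "'x::complex_hilbert \<Rightarrow> 'y::complex_hilbert"
    and T :: "'x \<Rightarrow> 'x"
    and S :: "complex \<Rightarrow> ('u::complex_hilbert \<Rightarrow>\<^sub>L 'y)"
    and Sc :: "nat \<Rightarrow> ('u \<Rightarrow>\<^sub>L 'y)"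
    and N :: "'x \<Rightarrow> 'u"
    and H :: "(complex \<Rightarrow> 'y) set"
    and ip :: "(complex \<Rightarrow> 'y) \<Rightarrow> (complex \<Rightarrow> 'y) \<Rightarrow> complex"
  assumes "bounded_clinear E" and "bounded_clinear T" and "output_stable E T"
    and "schur_class S"
    and "\<And>z. z \<in> \<D> \<Longrightarrow> (\<lambda>j. z ^ j *\<^sub>C Sc j) sums S z"
    and "is_HKS S H ip"
    and "N = (\<lambda>x. \<Sum>j. cadjoint (blinfun_apply (Sc j)) (E ((T ^^ j) x)))"
  shows
    "bounded_clinear N \<and>
     (\<forall>x. summable (\<lambda>j. cadjoint (blinfun_apply (Sc j)) (E ((T ^^ j) x)))) \<and>
     (\<forall>N'. bounded_clinear N' \<longrightarrow>
        (N' = N \<longleftrightarrow>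
         (\<forall>u. cadjoint N' u =
              adjoint_wrt H2_inner (observability E T) (mult_op S (const_fun u))))) \<and>
     (\<forall>x. AIP_admissible H ip S T E N x) \<and>
     H \<subseteq> H2 \<and>
     (\<forall>f\<in>H. adjoint_wrt ip (MFS S T E N) f = adjoint_wrt H2_inner (observability E T) f) \<and>
     (\<forall>f\<in>H.
        weak_sums (\<lambda>n. (cadjoint T ^^ n) (cadjoint E (taylor_coeff f n))) (left_eval E T f) \<and>
        left_eval E T f = adjoint_wrt H2_inner (observability E T) f) \<and>
     (\<forall>x. \<forall>f\<in>H.
        (ip_norm ip f \<le> 1 \<and> left_eval E T f = x) \<longleftrightarrow>
        (adjoint_wrt ip (MFS S T E N) f = x \<and> ip_norm ip f \<le> 1))"
proof -
  note E = assms(1) and T = assms(2) and stable = assms(3) and schur = assms(4) and Sc = assms(5)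
    and N = assms(7)
  interpret rkhs H ip "schur_kernel S" by (rule assms(6))
  interpret de_branges_rovnyak H ip S by unfold_locales (rule schur)

  \<comment> \<open>Observability operators of the two pairs\<close>
  define Ob where "Ob = observability_ell2 E T"
  \<comment> \<open>The candidate for the observability operator of \<open>(N, T)\<close>;
    \<open>On_nth\<close> confirms it.\<close>
  define On where "On x = mult_S_adj (Ob x)" for x
  have Ob: "bounded_clinear Ob"
    unfolding Ob_def by (rule bounded_clinear_observability[OF E T stable])
  have On: "bounded_clinear On"
    unfolding On_def
    by (rule bounded_clinear_compose[OF bounded_clinear_cadjoint[OF bounded_clinear_mult_S] Ob])
  have Ob_nth: "ell2_nth (Ob x) n = E ((T ^^ n) x)" for x n
    unfolding Ob_def by (rule ell2_nth_observability[OF stable])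
  have N_sums: "(\<lambda>j. cadjoint (blinfun_apply (Sc j)) (E ((T ^^ j) x))) sums ell2_nth (On x) 0" for x
    using ell2_nth_mult_S_adj_sums[OF Sc, where f = "Ob x" and n = 0] by (simp add: Ob_nth On_def)
  then have N_eq: "N x = ell2_nth (On x) 0" for x
    unfolding N by (rule sums_unique[symmetric])
  have On_nth: "ell2_nth (On x) n = N ((T ^^ n) x)" for x n
  proof -
    \<comment> \<open>The coefficients of \<open>Ob x\<close> from index \<open>n\<close> on are
      those of \<open>Ob ((T ^^ n) x)\<close>, so row \<open>n\<close> of the adjoint is the series
      of \<open>N\<close> at that vector.\<close>
    have "(\<lambda>j. cadjoint (blinfun_apply (Sc j)) (E ((T ^^ j) ((T ^^ n) x)))) sums ell2_nth (On x) n"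
      using ell2_nth_mult_S_adj_sums[OF Sc, where f = "Ob x" and n = n]
      by (simp add: Ob_nth On_def funpow_add)
    then show ?thesis
      unfolding N by (rule sums_unique)
  qed
  have Ob_fun: "observability E T x = ell2_fun (Ob x)" for x
    by (rule ell2_fun_eq_observability[symmetric]) (rule Ob_nth)
  have On_fun: "observability N T x = ell2_fun (On x)" for x
    by (rule ell2_fun_eq_observability[symmetric]) (rule On_nth)
  have MFS_eq: "MFS S T E N x = ell2_fun (defect (Ob x))" for x
    by (simp add: MFS_def Ob_fun On_fun defect_def ell2_fun_diff ell2_fun_mult_S flip: On_def)
  obtain K where K: "\<And>x. norm (On x) \<le> K * norm x"
    using bounded_clinear_norm_le[OF On] by blast
  have clin_N: "bounded_clinear N"
  proof (rule bounded_clinearI)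
    show "norm (N x) \<le> norm x * K" for x
      using order_trans[OF norm_ell2_nth_le K] by (simp add: N_eq mult.commute)
  qed (simp_all add: N_eq bounded_clinear_add[OF On] bounded_clinear_scale[OF On])

  \<comment> \<open>The adjoints in the two metrics and the left evaluation\<close>
  have adj_H2: "adjoint_wrt H2_inner (observability E T) (ell2_fun g) = cadjoint Ob g" for g
    by (rule adjoint_wrt_eqI) (simp add: Ob_fun H2_inner_ell2_fun cinner_cadjoint_right[OF Ob])
  \<comment> \<open>By \<open>ip_defect\<close>, pairing \<open>defect (Ob v)\<close> with
    \<open>g\<close> in \<open>H\<close> is pairing \<open>Ob v\<close> with \<open>g\<close> in the
    Hardy space, so both metrics lead to the same adjoint.\<close>
  have adj_ip: "adjoint_wrt ip (MFS S T E N) (ell2_fun g) = cadjoint Ob g" if "ell2_fun g \<in> H" for g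
    by (rule adjoint_wrt_eqI) (simp add: MFS_eq ip_defect[OF that] cinner_cadjoint_right[OF Ob])
  \<comment> \<open>Against \<open>v\<close>, term \<open>n\<close> becomes the pairing of
    coefficient \<open>n\<close> of \<open>g\<close> with \<open>E ((T ^^ n) v)\<close>; the series
    is thus the inner product of \<open>g\<close> and \<open>Ob v\<close>.\<close>
  have weak: "weak_sums (\<lambda>n. (cadjoint T ^^ n) (cadjoint E (taylor_coeff (ell2_fun g) n)))
      (cadjoint Ob g)" for g
    unfolding weak_sums_def
    using ell2_sums_cinner[of g "Ob v" for v]
    by (simp add: cinner_cadjoint_funpow[OF T] cinner_cadjoint_left[OF E]
        cinner_cadjoint_left[OF Ob] taylor_coeff_ell2_fun Ob_nth)
  have left_eval: "left_eval E T (ell2_fun g) = cadjoint Ob g" for g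
    unfolding left_eval_def by (rule weak_suminf_eq[OF weak])
  \<comment> \<open>The function \<open>S u\<close> is \<open>mult_S (ell2_single 0 u)\<close>, and
    coordinate 0 of \<open>On v\<close> is \<open>N v\<close>.\<close>
  have adj_N: "cadjoint N u = adjoint_wrt H2_inner (observability E T) (mult_op S (const_fun u))" for u
    unfolding ell2_fun_single_0[symmetric] ell2_fun_mult_S[symmetric] adj_H2
  proof (rule adjoint_wrt_eqI)
    show "cinner v (cadjoint Ob (mult_S (ell2_single 0 u))) = cinner (N v) u" for v
      by (simp add: cinner_cadjoint_right[OF Ob] N_eq On_def cinner_single_right[symmetric]
          cinner_cadjoint_left[OF bounded_clinear_mult_S])
  qed
  \<comment> \<open>For the converse direction of the equivalence: a bounded operator is determined
    by its adjoint.\<close>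
  have N_unique: "N' = N" if N': "bounded_clinear N'" and "\<And>u. cadjoint N' u = cadjoint N u" for N'
  proof
    fix v
    show "N' v = N v"
      by (rule cinner_ext_right)
        (simp add: cinner_cadjoint_right[OF N', symmetric] that(2) cinner_cadjoint_right[OF clin_N])
  qed

  \<comment> \<open>Admissibility and the Stein equation\<close>
  have admissible: "AIP_admissible H ip S T E N x" for x
    unfolding AIP_admissible_def Let_def
  proof (intro conjI allI)
    show "analytic_output_pair E T"
      using stable unfolding output_stable_def by blast
    show "analytic_output_pair N T"
      by (rule analytic_output_pairI[OF On_nth])
    show "MFS S T E N x \<in> H" for x
      unfolding MFS_eq by (rule defect_in_H)
    fix x
    have P: "adjoint_wrt ip (MFS S T E N) (MFS S T E N x) = cadjoint Ob (defect (Ob x))" for x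
      unfolding MFS_eq[of x] by (rule adj_ip[OF defect_in_H])
    show "adjoint_wrt ip (MFS S T E N) (MFS S T E N x) -
        cadjoint T (adjoint_wrt ip (MFS S T E N) (MFS S T E N (T x))) =
        cadjoint E (E x) - cadjoint N (N x)"
    proof (rule cinner_ext_left)
      fix v
      \<comment> \<open>The form of \<open>P\<close> is
        \<open>cinner (Ob v) (Ob x) - cinner (On v) (On x)\<close>; applying \<open>T\<close> to
        both arguments removes exactly the head terms, which are those of \<open>E\<close> and
        \<open>N\<close>.\<close>
      have "cinner (Ob v) (Ob x) = cinner (E v) (E x) + cinner (Ob (T v)) (Ob (T x))"
        by (subst cinner_ell2_split_head[of "Ob (T v)" "Ob v" "Ob (T x)" "Ob x"])
          (simp_all add: Ob_nth funpow_swap1)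
      moreover have "cinner (On v) (On x) = cinner (N v) (N x) + cinner (On (T v)) (On (T x))"
        by (subst cinner_ell2_split_head[of "On (T v)" "On v" "On (T x)" "On x"])
          (simp_all add: On_nth funpow_swap1)
      ultimately show "cinner v (adjoint_wrt ip (MFS S T E N) (MFS S T E N x) -
          cadjoint T (adjoint_wrt ip (MFS S T E N) (MFS S T E N (T x)))) =
          cinner v (cadjoint E (E x) - cadjoint N (N x))"
        unfolding P cinner_diff_right cinner_cadjoint_right[OF T] cinner_cadjoint_right[OF Ob]
          cinner_cadjoint_right[OF E] cinner_cadjoint_right[OF clin_N] cinner_defect
          On_def[symmetric]
        by simp
    qed
  qed (fact schur T E clin_N)+

  \<comment> \<open>Transfer to the elements of \<open>H\<close>\<close>
  have H_cases: "\<exists>g. f = ell2_fun g \<and> ell2_fun g \<in> H" if f: "f \<in> H" for f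
  proof -
    obtain g where "f = ell2_fun g"
      by (rule mem_H_represent[OF f])
    with f show ?thesis by blast
  qed
  have subset: "H \<subseteq> H2"
    using H_cases ell2_fun_in_H2 by blast
  have eq: "adjoint_wrt ip (MFS S T E N) f = adjoint_wrt H2_inner (observability E T) f"
    "left_eval E T f = adjoint_wrt H2_inner (observability E T) f"
    "weak_sums (\<lambda>n. (cadjoint T ^^ n) (cadjoint E (taylor_coeff f n))) (left_eval E T f)"
    if f: "f \<in> H" for f
  proof -
    obtain g where g: "f = ell2_fun g" "ell2_fun g \<in> H"
      using H_cases[OF f] by blast
    show "adjoint_wrt ip (MFS S T E N) f = adjoint_wrt H2_inner (observability E T) f"
      unfolding g(1) adj_H2 by (rule adj_ip[OF g(2)])
    show "left_eval E T f = adjoint_wrt H2_inner (observability E T) f"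
      unfolding g(1) adj_H2 by (rule left_eval)
    show "weak_sums (\<lambda>n. (cadjoint T ^^ n) (cadjoint E (taylor_coeff f n))) (left_eval E T f)"
      unfolding g(1) left_eval by (rule weak)
  qed
  have N_iff: "N' = N \<longleftrightarrow> (\<forall>u. cadjoint N' u =
      adjoint_wrt H2_inner (observability E T) (mult_op S (const_fun u)))"
    if "bounded_clinear N'" for N'
    unfolding adj_N[symmetric] using N_unique[OF that] by blast
  show ?thesis
    by (intro conjI allI ballI impI clin_N sums_summable[OF N_sums] N_iff admissible subset eq)
      (simp_all add: eq conj_commute)
qed

end
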